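(* Let $B>A>0$, $T>0$, and suppose that $(A,B)$ is in classical $q$-resonance for some $q\in\mathbb{N}$, i.e. $(B-A)/A=q$. Then the escaping set of the piecewise linear Fermi-Ulam accelerator with parameters $(A,B,T)$ constitutes a null set on the phase cylinder, and consequently the dynamics is recurrent in the sense that almost every orbit returns to its initial momentum level infinitely often.
   Context: Piecewise linear Fermi-Ulam accelerator: a point particle moves freely between two infinitely heavy walls and is reflected elastically by them. One wall is fixed. The other moves so that the distance between the walls is the $2T$-periodic function $l(t)=B-kt$ for $t\in[0,T)$, $l(t)=A+k(t-T)$ for $t\in[T,2T)$, where $k=(B-A)/T$. The dynamics is recorded by collisions at the moving wall: $t$ (mod $2T$) is the moment of collision at the moving wall and $v$ is the velocity immediately after that collision (counted positive towards the fixed wall). The phase cylinder is the space of such pairs; it has infinite volume, and "null set" and "almost every" refer to Lebesgue measure on it. The collision map sends one collision $(t_0,v_0)$ to the next one $(t_1,v_1)$; for $v_0$ large it is given by $v_0(t_1-t_0)=l(t_0)+l(t_1)$, $v_1=v_0-2\dot l(t_1)$. (For small $v_0$ the moving wall may hit the particle again before the particle reaches the fixed wall, and then the first equation does not hold.) An escaping orbit is one whose energy grows to infinity in time; the escaping set is the set of initial conditions of escaping orbits. The momentum is the adiabatic momentum $I(t,v)=\mathcal{T}\,(l(t)v+l(t)\dot l(t))$ with $\mathcal{T}=\int_0^T l(s)^{-2}\,ds=\frac{T}{AB}$. *)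

theory Defs
  imports "HOL-Analysis.Analysis" "HOL-Library.Real_Mod"
begin

definition wall_speed :: "real \<Rightarrow> real \<Rightarrow> real \<Rightarrow> real" where
  "wall_speed A B T = (B - A) / T"

definition wall_dist :: "real \<Rightarrow> real \<Rightarrow> real \<Rightarrow> real \<Rightarrow> real" where
  "wall_dist A B T t =
     (let s = t rmod (2 * T)
      in if s < T then B - wall_speed A B T * s else A + wall_speed A B T * (s - T))"

text \<open>
  The derivative of the distance. At the two corners per period it takes the value of the
  inward moving piece, i.e. the right derivative at \<open>0\<close> and the left derivative at \<open>T\<close>.
  Orbits that collide at a corner form a null set; with this choice the collision law below
  sends every outgoing state to an outgoing state, also at corners.
\<close>

definition wall_vel :: "real \<Rightarrow> real \<Rightarrow> real \<Rightarrow> real \<Rightarrow> real" where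
  "wall_vel A B T t =
     (if t rmod (2 * T) \<le> T then - wall_speed A B T else wall_speed A B T)"

text \<open>
  States \<open>(t, v)\<close> immediately after a collision: the particle leaves the moving wall, whose
  velocity towards the fixed wall is \<open>- wall_vel A B T t\<close>. In particular \<open>v\<close> may be
  negative while the moving wall recedes.
\<close>

definition phase_cylinder :: "real \<Rightarrow> real \<Rightarrow> real \<Rightarrow> (real \<times> real) set" where
  "phase_cylinder A B T = {(t, v). 0 \<le> t \<and> t < 2 * T \<and> - wall_vel A B T t < v}"

definition phase_measure :: "real \<Rightarrow> real \<Rightarrow> real \<Rightarrow> (real \<times> real) measure" where
  "phase_measure A B T = lebesgue_on (phase_cylinder A B T)"

text \<open>
  Distance from the fixed wall at time \<open>t\<close> of a particle that has left the moving wall at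
  time \<open>t0\<close> with velocity \<open>v0\<close> towards the fixed wall and has not met the moving wall since.
  The absolute value is the elastic reflection at the fixed wall.
\<close>

definition particle_dist :: "real \<Rightarrow> real \<Rightarrow> real \<Rightarrow> real \<times> real \<Rightarrow> real \<Rightarrow> real" where
  "particle_dist A B T = (\<lambda>(t0, v0) t. \<bar>wall_dist A B T t0 - v0 * (t - t0)\<bar>)"

text \<open>
  On the phase cylinder the set below is nonempty and has a least element, because the
  particle is strictly inside the wall just after \<open>t0\<close>.
\<close>

definition next_time :: "real \<Rightarrow> real \<Rightarrow> real \<Rightarrow> real \<times> real \<Rightarrow> real" where
  "next_time A B T z = Inf {t. fst z < t \<and> particle_dist A B T z t = wall_dist A B T t}"

text \<open>
  \<open>u\<close> is the velocity away from the fixed wall just before the collision at \<open>t1\<close>; it is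
  \<open>v0\<close> if the fixed wall has been hit in between, which gives
  \<open>v0 * (t1 - t0) = l t0 + l t1\<close>, and \<open>- v0\<close> otherwise. The collision reverses the
  velocity relative to the moving wall.
\<close>

definition collision_map :: "real \<Rightarrow> real \<Rightarrow> real \<Rightarrow> real \<times> real \<Rightarrow> real \<times> real" where
  "collision_map A B T = (\<lambda>(t0, v0).
     let t1 = next_time A B T (t0, v0);
         u = (if wall_dist A B T t0 < v0 * (t1 - t0) then v0 else - v0)
     in (t1 rmod (2 * T), u - 2 * wall_vel A B T t1))"

definition energy :: "real \<times> real \<Rightarrow> real" where
  "energy = (\<lambda>(t, v). v\<^sup>2 / 2)"

definition escaping_set :: "real \<Rightarrow> real \<Rightarrow> real \<Rightarrow> (real \<times> real) set" where
  "escaping_set A B T =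
     {z \<in> phase_cylinder A B T.
        filterlim (\<lambda>n. energy ((collision_map A B T ^^ n) z)) at_top sequentially}"

definition momentum :: "real \<Rightarrow> real \<Rightarrow> real \<Rightarrow> real \<times> real \<Rightarrow> real" where
  "momentum A B T = (\<lambda>(t, v).
     integral {0..T} (\<lambda>s. 1 / (wall_dist A B T s)\<^sup>2)
       * (wall_dist A B T t * v + wall_dist A B T t * wall_vel A B T t))"

text \<open>
  Return to the initial momentum level is understood as in the recurrence theorem of Poincare: infinitely
  many returns to every neighbourhood of the level.
\<close>

definition momentum_recurrent :: "real \<Rightarrow> real \<Rightarrow> real \<Rightarrow> real \<times> real \<Rightarrow> bool" where
  "momentum_recurrent A B T z \<longleftrightarrow>
     (\<forall>\<epsilon>>0. \<exists>\<^sub>F n in sequentially.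
        \<bar>momentum A B T ((collision_map A B T ^^ n) z) - momentum A B T z\<bar> < \<epsilon>)"

definition classical_resonance :: "real \<Rightarrow> real \<Rightarrow> nat \<Rightarrow> bool" where
  "classical_resonance A B q \<longleftrightarrow> (B - A) / A = real q"

end

(*
  Let k be the speed of the wall and q = (B - A)/A. For a fast particle, the collisions change the
  velocity only by multiples of 2k, and the adiabatic momentum is
  constant between two corners of the wall motion. In the coordinates
  phi = (T - t)(v - k)/(2A), U = T(v - k)/(2A), taken at the last collision before the minimal
  distance is reached, a full period of a fast particle is therefore exactly piecewise affine. In
  resonance it is
      phi' = 2r - phi - m,  U' = U + q(m - q),  r = (U - 1 + phi) mod (q + 1),  m = floor(2r - phi),
  so that phi is rotated by 2U mod 1 and U changes by integers: the angle alpha = 2U of the rotation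
  is a constant of motion. If P/Q is a very good approximation of alpha with P odd and Q even, then
  (q + 1)Q periods visit every residue class of U modulo q + 1 equally often, and the drift of U
  cancels up to a bounded error. Almost every alpha has infinitely many such approximations, hence a
  particle that stays fast returns infinitely often to bounded energy for almost every initial
  condition. Recurrence follows as in the theorem of Poincare, because the (injective) collision map
  preserves the flux measure (v + l'(t)) dt dv and almost every orbit visits a set of finite measure
  infinitely often.
*)

theory Submission
  imports Defs "HOL-Number_Theory.Cong"
begin

section \<open>Drift over a resonant period\<close>

text \<open>The parities of \<open>P\<close> and \<open>Q\<close> are what makes the drift cancel.
  Modulo \<open>q + 1\<close> the factor \<open>q\<close> is -1, so one period acts on the integer
  displacement \<open>j\<close> of \<open>U\<close> as \<open>j \<mapsto> 1 - j - c\<close>, where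
  \<open>c\<close> is an increment of a floor sequence. Two periods add a difference of consecutive
  increments, and over \<open>Q\<close> periods this alternating sum collapses to 1 or -1 because
  \<open>Q\<close> is even and \<open>P\<close> is odd. Blocks of \<open>Q\<close> periods therefore
  move the residue by a unit, and \<open>q + 1\<close> blocks exhaust all residue classes.

  Replacing \<alpha> by \<open>P / Q\<close> is harmless only while no rounding in the period map
  changes. The error accumulated over \<open>(q + 1) * Q\<close> periods must be small against cells
  of length \<open>1 / Q\<close>, which asks for
  \<open>\<bar>Q * \<alpha> - P\<bar> < \<epsilon> / Q\<close> with every
  \<open>\<epsilon> > 0\<close>. Elementary approximation with the right parities gives a fixed
  constant only; a density argument improves it to any \<epsilon> for almost every \<alpha>.

  As the angle is a constant of motion, the bad states form a null set found by Fubini, with no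
  appeal to ergodicity; invariance of the flux carries it along orbits.\<close>

lemma bij_betw_residues:
  fixes g P :: int and Q :: nat
  assumes "coprime P (int Q)" "0 < Q"
  shows "bij_betw (\<lambda>k. (g + int k * P) mod int Q) {..<Q} {0..<int Q}"
proof -
  have inj: "inj_on (\<lambda>k. (g + int k * P) mod int Q) {..<Q}"
  proof (rule inj_onI)
    fix k l assume kl: "k \<in> {..<Q}" "l \<in> {..<Q}"
      and eq: "(g + int k * P) mod int Q = (g + int l * P) mod int Q"
    have "[int k * P = int l * P] (mod int Q)"
      using eq by (simp add: cong_def[symmetric] cong_add_lcancel)
    then have "[int k = int l] (mod int Q)"
      using assms(1) cong_mult_rcancel by blast
    then show "k = l" using kl by (simp add: cong_def)
  qed
  have "(\<lambda>k. (g + int k * P) mod int Q) ` {..<Q} = {0..<int Q}"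
  proof (rule card_subset_eq)
    show "card ((\<lambda>k. (g + int k * P) mod int Q) ` {..<Q}) = card {0..<int Q}"
      by (simp add: card_image[OF inj])
  qed (use assms in auto)
  then show ?thesis using inj by (simp add: bij_betw_def)
qed

lemma sum_residues:
  fixes g P :: int and Q :: nat and f :: "int \<Rightarrow> int"
  assumes "coprime P (int Q)" "0 < Q"
  shows "(\<Sum>k<Q. f ((g + int k * P) mod int Q)) = (\<Sum>r<Q. f (int r))"
proof -
  have "(\<Sum>k<Q. f ((g + int k * P) mod int Q)) = sum f {0..<int Q}"
    by (rule sum.reindex_bij_betw[OF bij_betw_residues[OF assms]])
  also have "{0..<int Q} = int ` {..<Q}"
    by (simp add: image_int_atLeastLessThan lessThan_atLeast0)
  finally show ?thesis by (simp add: sum.reindex)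
qed

lemma gauss_sum_lessThan_int: "2 * (\<Sum>r<n. int r) = int n * (int n - 1)"
  by (induction n) (auto simp: algebra_simps)

text \<open>The remainders modulo \<open>Q\<close> run through a complete residue system, so their
  sum depends on neither \<open>g\<close> nor \<open>P\<close>; subtracting it from the sum of the
  numerators leaves \<open>Q\<close> times the sum of the quotients.\<close>

lemma sum_floor_line:
  fixes g P :: int and Q :: nat
  assumes "coprime P (int Q)" "0 < Q"
  shows "2 * (\<Sum>k<Q. (g + int k * P) div int Q) = 2 * g + (P - 1) * (int Q - 1)"
proof -
  let ?d = "\<lambda>k. (g + int k * P) div int Q" and ?m = "\<lambda>k. (g + int k * P) mod int Q"
  have "(\<Sum>k<Q. g + int k * P) = (\<Sum>k<Q. int Q * ?d k + ?m k)" by simp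
  then have "int Q * g + (\<Sum>k<Q. int k) * P = int Q * (\<Sum>k<Q. ?d k) + (\<Sum>k<Q. ?m k)"
    by (simp only: sum.distrib sum_distrib_left[symmetric] sum_distrib_right[symmetric]) simp
  then have "int Q * (\<Sum>k<Q. ?d k) = int Q * g + P * (\<Sum>k<Q. int k) - (\<Sum>r<Q. int r)"
    using sum_residues[OF assms, of "\<lambda>x. x" g] by (simp add: mult.commute)
  then have "int Q * (2 * (\<Sum>k<Q. ?d k)) = 2 * int Q * g + P * (2 * (\<Sum>k<Q. int k)) - 2 * (\<Sum>r<Q. int r)"
    by linarith
  also have "\<dots> = int Q * (2 * g + (P - 1) * (int Q - 1))"
    unfolding gauss_sum_lessThan_int by (simp add: algebra_simps)
  finally show ?thesis using assms(2) by simp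
qed

lemma alternating_sum_lessThan:
  "even n \<Longrightarrow> 2 * (\<Sum>r<n. (-1) ^ r * int r) = - int n"
proof -
  have "2 * (\<Sum>r<2 * m. (-1) ^ r * int r) = - int (2 * m)" for m
    by (induction m) auto
  then show "even n \<Longrightarrow> ?thesis" by (elim evenE) simp
qed

definition sgn_parity :: "int \<Rightarrow> int" where
  "sgn_parity n = (if even n then 1 else -1)"

lemma sgn_parity_simps [simp]:
  "sgn_parity (int n) = (-1) ^ n" "sgn_parity (a + b) = sgn_parity a * sgn_parity b"
  by (auto simp: sgn_parity_def)

text \<open>As \<open>Q\<close> is even, a remainder modulo \<open>Q\<close> has the parity of its
  numerator, and as \<open>P\<close> is odd this parity alternates with \<open>k\<close>. Up to the
  sign given by \<open>g\<close>, the factor \<open>(-1) ^ k\<close> is thus a function of the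
  remainder, and the alternating sum of remainders again runs over a complete residue
  system.\<close>

lemma alternating_sum_floor_line:
  fixes g P :: int and Q :: nat
  assumes cop: "coprime P (int Q)" and "0 < Q" "even Q" "odd P"
  shows "2 * (\<Sum>k<Q. (-1) ^ k * ((g + int k * P) div int Q)) = sgn_parity g - P"
proof -
  let ?d = "\<lambda>k. (g + int k * P) div int Q" and ?m = "\<lambda>k. (g + int k * P) mod int Q"
  have sg: "sgn_parity (?m k) = sgn_parity g * (-1) ^ k" for k
  proof -
    have "even (?m k) \<longleftrightarrow> even (g + int k * P)"
      using \<open>even Q\<close> by (simp add: dvd_mod_iff)
    then show ?thesis using \<open>odd P\<close> by (auto simp: sgn_parity_def)
  qed
  have sg2: "sgn_parity g * sgn_parity g = 1" by (simp add: sgn_parity_def)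
  have m: "(\<Sum>k<Q. (-1) ^ k * ?m k) = sgn_parity g * (\<Sum>r<Q. (-1) ^ r * int r)"
  proof -
    have "(\<Sum>k<Q. (-1) ^ k * ?m k) = (\<Sum>k<Q. (sgn_parity g * sgn_parity (?m k)) * ?m k)"
      by (intro sum.cong refl) (simp add: sg sg2 mult.assoc[symmetric])
    also have "\<dots> = (\<Sum>r<Q. (sgn_parity g * sgn_parity (int r)) * int r)"
      by (rule sum_residues[OF cop \<open>0 < Q\<close>])
    finally show ?thesis by (simp add: sum_distrib_left mult.assoc)
  qed
  have alt0: "(\<Sum>k<Q. (-1) ^ k * g) = 0"
  proof -
    have "(\<Sum>k<2 * n. (-1) ^ k * g) = 0" for n by (induction n) auto
    then show ?thesis using \<open>even Q\<close> by (auto elim!: evenE)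
  qed
  have "(\<Sum>k<Q. (-1) ^ k * (g + int k * P)) = (\<Sum>k<Q. (-1) ^ k * (int Q * ?d k + ?m k))" by simp
  then have "int Q * (\<Sum>k<Q. (-1) ^ k * ?d k)
      = P * (\<Sum>k<Q. (-1) ^ k * int k) - (\<Sum>k<Q. (-1) ^ k * ?m k)"
    using alt0 by (simp only: distrib_left sum.distrib) (simp add: sum_distrib_left algebra_simps)
  then have "int Q * (2 * (\<Sum>k<Q. (-1) ^ k * ?d k))
      = P * (2 * (\<Sum>k<Q. (-1) ^ k * int k)) - sgn_parity g * (2 * (\<Sum>r<Q. (-1) ^ r * int r))"
    unfolding m by (simp add: algebra_simps)
  also have "\<dots> = int Q * (sgn_parity g - P)"
    unfolding alternating_sum_lessThan[OF \<open>even Q\<close>] by (simp add: algebra_simps)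
  finally show ?thesis using \<open>0 < Q\<close> by simp
qed

text \<open>Summation by parts: the boundary terms give \<open>N 0 - N Q = - P\<close>, which
  cancels the \<open>P\<close> of \<open>alternating_sum_floor_line\<close>. The unit that survives
  is what moves the residue class of the drift.\<close>

lemma alternating_sum_floor_increments:
  fixes g P :: int and Q :: nat
  assumes "coprime P (int Q)" "0 < Q" "even Q" "odd P"
  defines "N \<equiv> \<lambda>k. (g + int k * P) div int Q"
  shows "(\<Sum>k<Q. (-1) ^ k * (N (Suc k) - N k)) = - sgn_parity g"
proof -
  have NQ: "N Q = N 0 + P" using assms(2) by (simp add: N_def)
  have tel: "(\<Sum>k<n. (-1) ^ k * (N (Suc k) - N k)) 
      = - 2 * (\<Sum>k<n. (-1) ^ k * N k) + N 0 - (-1) ^ n * N n" for n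
    by (induction n) (auto simp: algebra_simps)
  have "2 * (\<Sum>k<Q. (-1) ^ k * N k) = sgn_parity g - P"
    unfolding N_def by (rule alternating_sum_floor_line[OF assms(1-4)])
  then show ?thesis using \<open>even Q\<close> unfolding tel NQ by simp
qed

text \<open>In the increments of \<open>j\<close> the terms \<open>2 * (... mod ...)\<close> and
  \<open>- q\<close> balance once all \<open>q + 1\<close> residues have occurred equally often. The
  rest telescopes or is evaluated by \<open>sum_floor_line\<close>. The remaining factor is the
  second difference \<open>(g + P) - 2 * g' + g\<close>, which is small in the application.\<close>

lemma drift_over_resonant_period:
  fixes g g' P :: int and Q q :: nat and N M j :: "nat \<Rightarrow> int"
  assumes cop: "coprime P (int Q)" and Q: "0 < Q" "even Q" and P: "odd P"
    and N: "\<And>k. N k = (g + int k * P) div int Q"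
    and M: "\<And>k. M k = (g' + int k * P) div int Q"
    and j: "\<And>k. j (Suc k) = j k + int q * ((N (Suc k) - N k) - 2 * (M k - N k)
        + 2 * ((j k - 1 + (M k - N k)) mod int (Suc q)) - int q)"
  shows "j (Suc q * Q) = j 0 + int (q * Suc q) * (P - 2 * (g' - g))"
proof -
  define c where "c = (\<lambda>k. N (Suc k) - N k)"
  define s where "s = (\<lambda>k. M k - N k)"
  define n where "n = int (Suc q)"
  have n: "n = int q + 1" by (simp add: n_def)
  \<comment> \<open>Modulo \<open>n\<close> the factor \<open>q\<close> is -1 and the inner
    \<open>mod\<close> disappears; the terms with \<open>s\<close> cancel.\<close>
  have step: "[j (Suc k) = 1 - j k - c k] (mod n)" for k
  proof -
    let ?m = "(j k - 1 + s k) mod n"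
    have "[?m = j k - 1 + s k] (mod n)" by (simp add: cong_def)
    then have "[int q * (c k - 2 * s k + 2 * ?m - int q) = (-1) * (c k - 2 * s k + 2 * (j k - 1 + s k) - (-1))] (mod n)"
      by (intro cong_mult cong_diff cong_add cong_refl) (auto simp: n cong_iff_dvd_diff)
    then have "[j k + int q * (c k - 2 * s k + 2 * ?m - int q)
        = j k + (-1) * (c k - 2 * s k + 2 * (j k - 1 + s k) - (-1))] (mod n)"
      by (intro cong_add cong_refl)
    then show ?thesis by (simp add: j c_def s_def n_def algebra_simps)
  qed
  have step2: "[j (Suc (Suc k)) = j k + c k - c (Suc k)] (mod n)" for k
  proof -
    have "[1 - j (Suc k) - c (Suc k) = 1 - (1 - j k - c k) - c (Suc k)] (mod n)"
      by (intro cong_diff cong_refl step)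
    from cong_trans[OF step this] show ?thesis by (simp add: algebra_simps)
  qed
  have steps: "[j (k + 2 * m) = j k + (\<Sum>l<2 * m. (-1) ^ l * c (k + l))] (mod n)" for k m
  proof (induction m)
    case (Suc m)
    have "[j (k + 2 * m) + c (k + 2 * m) - c (Suc (k + 2 * m))
       = j k + (\<Sum>l<2 * m. (-1) ^ l * c (k + l)) + c (k + 2 * m) - c (Suc (k + 2 * m))] (mod n)"
      by (intro cong_diff cong_add cong_refl Suc)
    from cong_trans[OF step2 this] show ?case by (simp add: algebra_simps)
  qed simp
  \<comment> \<open>A block starting at \<open>k\<close> sees the line with \<open>g\<close>
    replaced by \<open>g + k * P\<close>, so its alternating sum is again a unit.\<close>
  have period: "[j (k + Q) = j k - sgn_parity (g + int k * P)] (mod n)" for k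
  proof -
    have "(\<Sum>l<Q. (-1) ^ l * c (k + l))
       = (\<Sum>l<Q. (-1) ^ l * ((g + int k * P + int (Suc l) * P) div int Q - (g + int k * P + int l * P) div int Q))"
      unfolding c_def N by (intro sum.cong refl) (simp add: algebra_simps)
    also have "\<dots> = - sgn_parity (g + int k * P)"
      by (rule alternating_sum_floor_increments[OF cop Q P])
    finally show ?thesis using steps[of k "Q div 2"] Q(2) by simp
  qed
  have periods: "[j (k + b * Q) = j k + int b * (- sgn_parity (g + int k * P))] (mod n)" for k b
  proof (induction b)
    case (Suc b)
    \<comment> \<open>\<open>b * Q * P\<close> is even, so all blocks starting at some
      \<open>k + b * Q\<close> shift the residue in the same direction.\<close>
    have sg: "sgn_parity (g + int (k + b * Q) * P) = sgn_parity (g + int k * P)"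
      using Q(2) by (auto simp: sgn_parity_def)
    have "[j (k + b * Q + Q) = j (k + b * Q) - sgn_parity (g + int k * P)] (mod n)"
      using period[of "k + b * Q"] unfolding sg .
    moreover have "[j (k + b * Q) - sgn_parity (g + int k * P) 
        = j k + int b * (- sgn_parity (g + int k * P)) - sgn_parity (g + int k * P)] (mod n)"
      by (intro cong_diff cong_refl Suc)
    ultimately show ?case using cong_trans by (fastforce simp: algebra_simps)
  qed simp
  have s_per: "s (k + b * Q) = s k" for k b
  proof -
    have "(h + int (k + b * Q) * P) div int Q = (h + int k * P) div int Q + int b * P" for h
    proof -
      have "h + int (k + b * Q) * P = (h + int k * P) + (int b * P) * int Q" by (simp add: algebra_simps)
      then show ?thesis using Q(1) by (metis add.commute div_mult_self1 of_nat_0_less_iff order_less_irrefl)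
    qed
    then show ?thesis by (simp add: s_def N M)
  qed
  \<comment> \<open>For fixed \<open>k\<close> the residues form an arithmetic progression in
    \<open>b\<close> with difference 1 or -1, so \<open>b = 0, ..., q\<close> meets every class
    once.\<close>
  have resid: "2 * (\<Sum>b<Suc q. (j (k + b * Q) - 1 + s (k + b * Q)) mod n) = n * int q" for k
  proof -
    let ?e = "- sgn_parity (g + int k * P)"
    have "(j (k + b * Q) - 1 + s (k + b * Q)) mod n = ((j k - 1 + s k) + int b * ?e) mod int (Suc q)" for b
    proof -
      have "[j (k + b * Q) - 1 + s k = j k + int b * ?e - 1 + s k] (mod n)"
        by (intro cong_add cong_diff cong_refl periods)
      then show ?thesis unfolding s_per by (simp add: cong_def n_def algebra_simps)
    qed
    then have "(\<Sum>b<Suc q. (j (k + b * Q) - 1 + s (k + b * Q)) mod n)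
       = (\<Sum>b<Suc q. ((j k - 1 + s k) + int b * ?e) mod int (Suc q))" by (intro sum.cong) auto
    also have "\<dots> = (\<Sum>b<Suc q. int b)"
      by (rule sum_residues[where f = "\<lambda>x. x"]) (auto simp: sgn_parity_def)
    finally show ?thesis using gauss_sum_lessThan_int[of "Suc q"] by (simp add: n)
  qed
  have group: "(\<Sum>m<Suc q * Q. f m) = (\<Sum>k<Q. \<Sum>b<Suc q. f (k + b * Q))" for f :: "nat \<Rightarrow> int"
  proof -
    have "(\<Sum>m<Suc q * Q. f m) = (\<Sum>b<Suc q. sum f {b * Q ..< b * Q + Q})"
      by (rule sum.nat_group[symmetric])
    also have "\<dots> = (\<Sum>b<Suc q. \<Sum>k<Q. f (k + b * Q))"
    proof (rule sum.cong[OF refl])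
      fix b
      show "sum f {b * Q ..< b * Q + Q} = (\<Sum>k<Q. f (k + b * Q))"
        using sum.shift_bounds_nat_ivl[of f 0 "b * Q" Q]
        by (simp add: lessThan_atLeast0 add.commute)
    qed
    also have "\<dots> = (\<Sum>k<Q. \<Sum>b<Suc q. f (k + b * Q))" by (rule sum.swap)
    finally show ?thesis .
  qed
  have c_sum: "(\<Sum>m<Suc q * Q. c m) = n * P"
  proof -
    have "(\<Sum>m<Suc q * Q. c m) = N (Suc q * Q) - N 0"
      unfolding c_def by (rule sum_lessThan_telescope)
    also have "N (Suc q * Q) = N 0 + n * P"
    proof -
      have eq: "g + int (Suc q * Q) * P = g + (n * P) * int Q" by (simp add: n algebra_simps)
      show ?thesis using Q(1) unfolding N eq by simp
    qed
    finally show ?thesis by simp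
  qed
  have s_sum: "(\<Sum>m<Suc q * Q. s m) = n * (g' - g)"
  proof -
    have "2 * (\<Sum>k<Q. s k) = 2 * (g' - g)"
      using sum_floor_line[OF cop Q(1), of g] sum_floor_line[OF cop Q(1), of g']
      by (simp add: s_def M N sum_subtractf)
    then have s1: "(\<Sum>k<Q. s k) = g' - g" by simp
    have "(\<Sum>m<Suc q * Q. s m) = n * (\<Sum>k<Q. s k)"
      unfolding group s_per by (simp add: n sum_distrib_left distrib_right add.commute)
    then show ?thesis unfolding s1 .
  qed
  have m_sum: "2 * (\<Sum>m<Suc q * Q. (j m - 1 + s m) mod n) = int Q * (n * int q)"
    unfolding group sum_distrib_left[of 2 _ "{..<Q}"] resid by simp
  have "j (Suc q * Q) - j 0 = (\<Sum>m<Suc q * Q. j (Suc m) - j m)"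
    by (rule sum_lessThan_telescope[symmetric])
  also have "\<dots> = (\<Sum>m<Suc q * Q. int q * (c m - 2 * s m + 2 * ((j m - 1 + s m) mod n) - int q))"
    by (intro sum.cong refl) (simp add: j c_def s_def n_def)
  also have "\<dots> = int q * ((\<Sum>m<Suc q * Q. c m) - 2 * (\<Sum>m<Suc q * Q. s m)
      + 2 * (\<Sum>m<Suc q * Q. (j m - 1 + s m) mod n) - (\<Sum>m<Suc q * Q. int q))"
    by (simp only: sum_distrib_left[symmetric] sum.distrib sum_subtractf)
  also have "\<dots> = int q * (n * (P - 2 * (g' - g)))"
    unfolding c_sum s_sum m_sum by (simp add: n algebra_simps)
  finally show ?thesis by (simp add: n algebra_simps)
qed

section \<open>Diophantine approximation with odd numerator and even denominator\<close>

text \<open>The argument works with the outer measure \<open>m\<close> of \<open>S\<close>. Vitali's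
  theorem covers \<open>S\<close> up to a null set by disjoint balls inside a set of measure below
  \<open>m + 2 * e\<close>, and in each ball a proportion \<theta> of its measure suffices to cover
  \<open>S\<close>. Hence \<open>m \<le> \<theta> * (m + 2 * e)\<close> for all
  \<open>e > 0\<close>, which forces \<open>m = 0\<close>.\<close>

lemma negligible_if_upper_density_less_one_bounded:
  fixes S :: "'a::euclidean_space set"
  assumes "bounded S" and \<theta>: "0 \<le> \<theta>" "\<theta> < 1"
    and dens: "\<And>x r. x \<in> S \<Longrightarrow> r > 0 \<Longrightarrow> \<exists>d U. 0 < d \<and> d < r \<and> S \<inter> cball x d \<subseteq> U \<and>
       U \<in> lmeasurable \<and> measure lebesgue U \<le> \<theta> * measure lebesgue (cball x d)"
  shows "negligible S"
proof -
  define \<C> where "\<C> = {T. S \<subseteq> T \<and> T \<in> lmeasurable}"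
  define m where "m = Inf (measure lebesgue ` \<C>)"
  obtain a b where "S \<subseteq> cbox a b" using \<open>bounded S\<close> bounded_subset_cbox_symmetric by blast
  then have ne: "measure lebesgue ` \<C> \<noteq> {}" by (auto simp: \<C>_def intro!: exI[of _ "cbox a b"])
  have bdd: "bdd_below (measure lebesgue ` \<C>)" by (rule bdd_belowI[of _ 0]) auto
  have m0: "0 \<le> m" unfolding m_def by (rule cInf_greatest[OF ne]) auto
  have m_le: "m \<le> measure lebesgue T" if "S \<subseteq> T" "T \<in> lmeasurable" for T
    unfolding m_def by (rule cInf_lower[OF _ bdd]) (use that in \<open>auto simp: \<C>_def\<close>)
  have shrink: "m \<le> \<theta> * (m + 2 * e)" if "e > 0" for e
  proof -
    obtain T where T: "S \<subseteq> T" "T \<in> lmeasurable" "measure lebesgue T < m + e"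
      using cInf_lessD[OF ne, of "m + e"] \<open>e > 0\<close> unfolding m_def \<C>_def by auto
    obtain V where V: "open V" "T \<subseteq> V" "V - T \<in> lmeasurable" "emeasure lebesgue (V - T) < ennreal e"
      using sets_lebesgue_outer_open[OF fmeasurableD[OF T(2)] \<open>e > 0\<close>] .
    have VT: "T \<union> V = V" using V(2) by blast
    have "measure lebesgue (V - T) < e"
      using V(3,4) \<open>e > 0\<close> by (simp add: emeasure_eq_measure2 ennreal_less_iff)
    then have V': "V \<in> lmeasurable" "measure lebesgue V < measure lebesgue T + e"
      using measure_Un_le[OF fmeasurableD[OF T(2)] fmeasurableD[OF V(3)]] fmeasurable.Un[OF T(2) V(3)]
      by (simp_all add: VT)
    \<comment> \<open>Pairs of centre and radius. The set covering \<open>S\<close> is cut down to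
      the ball, so that those of disjoint balls are disjoint.\<close>
    define K where "K = {(x, d). 0 < d \<and> cball x d \<subseteq> V \<and> (\<exists>U. S \<inter> cball x d \<subseteq> U \<and> U \<subseteq> cball x d \<and>
       U \<in> lmeasurable \<and> measure lebesgue U \<le> \<theta> * measure lebesgue (cball x d))}"
    have Kpos: "0 < snd i" if "i \<in> K" for i using that by (auto simp: K_def)
    have cov: "\<exists>i. i \<in> K \<and> x \<in> cball (fst i) (snd i) \<and> snd i < r" if "x \<in> S" "0 < r" for x r
    proof -
      from that T(1) V(1,2) obtain r' where r': "r' > 0" "cball x r' \<subseteq> V"
        by (meson open_contains_cball subsetD)
      obtain d U where d: "0 < d" "d < min r r'" "S \<inter> cball x d \<subseteq> U" "U \<in> lmeasurable"
        "measure lebesgue U \<le> \<theta> * measure lebesgue (cball x d)"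
        using dens[OF \<open>x \<in> S\<close>, of "min r r'"] r' \<open>0 < r\<close> by auto
      have "measure lebesgue (U \<inter> cball x d) \<le> measure lebesgue U"
        using d(4) by (intro measure_mono_fmeasurable) (auto simp: fmeasurableD)
      moreover have "U \<inter> cball x d \<in> lmeasurable" using d(4) by (auto intro: fmeasurable.Int)
      ultimately have "(x, d) \<in> K"
        using d r' subset_cball[of d r' x] unfolding K_def by (fastforce intro!: exI[of _ "U \<inter> cball x d"])
      then show ?thesis using d by (intro exI[of _ "(x, d)"]) auto
    qed
    obtain C where C: "countable C" "C \<subseteq> K"
      "pairwise (\<lambda>i j. disjnt (cball (fst i) (snd i)) (cball (fst j) (snd j))) C"
      "negligible (S - (\<Union>i \<in> C. cball (fst i) (snd i)))"
      by (rule Vitali_covering_theorem_cballs[of K snd S fst, OF Kpos cov that])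
    have "\<forall>i\<in>C. \<exists>U. S \<inter> cball (fst i) (snd i) \<subseteq> U \<and> U \<subseteq> cball (fst i) (snd i) \<and>
       U \<in> lmeasurable \<and> measure lebesgue U \<le> \<theta> * measure lebesgue (cball (fst i) (snd i))"
      using C(2) by (auto simp: K_def)
    then obtain U where U: "\<And>i. i \<in> C \<Longrightarrow> S \<inter> cball (fst i) (snd i) \<subseteq> U i"
       "\<And>i. i \<in> C \<Longrightarrow> U i \<subseteq> cball (fst i) (snd i)" "\<And>i. i \<in> C \<Longrightarrow> U i \<in> lmeasurable"
       "\<And>i. i \<in> C \<Longrightarrow> measure lebesgue (U i) \<le> \<theta> * measure lebesgue (cball (fst i) (snd i))"
      by metis
    have dis: "disjoint_family_on (\<lambda>i. cball (fst i) (snd i)) C"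
      using C(3) by (auto simp: disjoint_family_on_def pairwise_def disjnt_def)
    have disU: "disjoint_family_on U C"
      using dis U(2) unfolding disjoint_family_on_def by blast
    have em: "emeasure lebesgue (U i) \<le> ennreal \<theta> * emeasure lebesgue (cball (fst i) (snd i))" if "i \<in> C" for i
      using U(4)[OF that] \<theta>(1)
      unfolding emeasure_eq_measure2[OF U(3)[OF that]] emeasure_eq_measure2[OF lmeasurable_cball]
      by (simp only: ennreal_mult[symmetric] measure_nonneg ennreal_leI)
    have ballsV: "(\<Union>i\<in>C. cball (fst i) (snd i)) \<subseteq> V" using C(2) by (fastforce simp: K_def)
    have "emeasure lebesgue (\<Union>i\<in>C. U i) = (\<integral>\<^sup>+i. emeasure lebesgue (U i) \<partial>count_space C)"
      by (rule emeasure_UN_countable[OF _ C(1) disU]) (use U(3) in auto)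
    also have "\<dots> \<le> (\<integral>\<^sup>+i. ennreal \<theta> * emeasure lebesgue (cball (fst i) (snd i)) \<partial>count_space C)"
      by (rule nn_integral_mono) (simp only: space_count_space em)
    also have "\<dots> = ennreal \<theta> * (\<integral>\<^sup>+i. emeasure lebesgue (cball (fst i) (snd i)) \<partial>count_space C)"
      by (rule nn_integral_cmult) simp
    also have "(\<integral>\<^sup>+i. emeasure lebesgue (cball (fst i) (snd i)) \<partial>count_space C) 
        = emeasure lebesgue (\<Union>i\<in>C. cball (fst i) (snd i))"
      by (rule emeasure_UN_countable[symmetric, OF _ C(1) dis]) auto
    also have "\<dots> \<le> emeasure lebesgue V"
      by (rule emeasure_mono[OF ballsV]) (use V' in auto)
    finally have emU: "emeasure lebesgue (\<Union>i\<in>C. U i) \<le> ennreal \<theta> * emeasure lebesgue V"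
      by (simp add: mult_left_mono)
    have UC: "(\<Union>i\<in>C. U i) \<in> lmeasurable"
    proof (rule fmeasurableI2[OF V'(1)])
      show "(\<Union>i\<in>C. U i) \<subseteq> V" using ballsV U(2) by blast
      show "(\<Union>i\<in>C. U i) \<in> sets lebesgue" using U(3) C(1) by (intro sets.countable_UN') auto
    qed
    then have mU: "measure lebesgue (\<Union>i\<in>C. U i) \<le> \<theta> * measure lebesgue V"
      using emU \<theta>(1) unfolding emeasure_eq_measure2[OF UC] emeasure_eq_measure2[OF V'(1)]
      by (simp add: ennreal_mult[symmetric])
    let ?N = "S - (\<Union>i \<in> C. cball (fst i) (snd i))"
    have "m \<le> measure lebesgue ((\<Union>i\<in>C. U i) \<union> ?N)"
    proof (rule m_le)
      show "S \<subseteq> (\<Union>i\<in>C. U i) \<union> ?N" using U(1) by blast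
      show "(\<Union>i\<in>C. U i) \<union> ?N \<in> lmeasurable"
        by (rule fmeasurable.Un[OF UC negligible_imp_measurable[OF C(4)]])
    qed
    also have "\<dots> = measure lebesgue (\<Union>i\<in>C. U i)"
      using C(4) by (intro measure_Un_null_set fmeasurableD[OF UC]) (simp only: negligible_iff_null_sets)
    also have "\<dots> \<le> \<theta> * measure lebesgue V" by (rule mU)
    also have "\<dots> \<le> \<theta> * (m + 2 * e)" using \<theta>(1) T(3) V'(2) by (intro mult_left_mono) auto
    finally show ?thesis .
  qed
  have "m = 0"
  proof (rule ccontr)
    assume "m \<noteq> 0"
    then have "m > 0" using m0 by simp
    \<comment> \<open>With this \<open>e\<close> the excess \<open>2 * \<theta> * e\<close> is only
      the fraction \<open>\<theta> / 2\<close> of the gap \<open>m * (1 - \<theta>)\<close>.\<close>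
    then have "m * (1 - \<theta>) / 4 > 0" using \<theta> by simp
    from shrink[OF this] have "m \<le> \<theta> * m + m * (1 - \<theta>) * (\<theta> / 2)"
      by (simp add: field_simps)
    moreover have "m * (1 - \<theta>) = m - \<theta> * m" by (simp add: right_diff_distrib)
    ultimately have "m * (1 - \<theta>) \<le> m * (1 - \<theta>) * (\<theta> / 2)" by linarith
    moreover have "m * (1 - \<theta>) > 0" using \<open>m > 0\<close> \<theta> by simp
    ultimately have "1 \<le> \<theta> / 2" by (metis mult.right_neutral mult_le_cancel_left_pos)
    then show False using \<theta> by simp
  qed
  show ?thesis
    unfolding negligible_outer
  proof (intro allI impI)
    fix e :: real assume "e > 0"
    then show "\<exists>T. S \<subseteq> T \<and> T \<in> lmeasurable \<and> measure lebesgue T < e"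
      using cInf_lessD[OF ne, of e] \<open>m = 0\<close> unfolding m_def \<C>_def by auto
  qed
qed

lemma negligible_if_upper_density_less_one:
  fixes S :: "'a::euclidean_space set"
  assumes \<theta>: "0 \<le> \<theta>" "\<theta> < 1"
    and dens: "\<And>x r. x \<in> S \<Longrightarrow> r > 0 \<Longrightarrow> \<exists>d U. 0 < d \<and> d < r \<and> S \<inter> cball x d \<subseteq> U \<and>
       U \<in> lmeasurable \<and> measure lebesgue U \<le> \<theta> * measure lebesgue (cball x d)"
  shows "negligible S"
proof -
  have "negligible (S \<inter> ball 0 (real n))" for n
  proof (rule negligible_if_upper_density_less_one_bounded[OF _ \<theta>])
    show "bounded (S \<inter> ball 0 (real n))" by (simp add: bounded_Int)
    fix x :: 'a and r :: real
    show "\<exists>d U. 0 < d \<and> d < r \<and> S \<inter> ball 0 (real n) \<inter> cball x d \<subseteq> U \<and>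
       U \<in> lmeasurable \<and> measure lebesgue U \<le> \<theta> * measure lebesgue (cball x d)"
      if x: "x \<in> S \<inter> ball 0 (real n)" "r > 0"
    proof -
      from x obtain d U where "0 < d" "d < r" "S \<inter> cball x d \<subseteq> U" "U \<in> lmeasurable"
        "measure lebesgue U \<le> \<theta> * measure lebesgue (cball x d)" using dens[of x r] by auto
      then show ?thesis by (intro exI[of _ d] exI[of _ U]) auto
    qed
  qed
  then have "negligible (\<Union> (range (\<lambda>n. S \<inter> ball 0 (real n))))"
    by (intro negligible_countable_Union) (simp, blast)
  moreover have "(\<Union>n. S \<inter> ball 0 (real n)) = S"
  proof -
    have "x \<in> (\<Union>n. S \<inter> ball 0 (real n))" if "x \<in> S" for x
      using that reals_Archimedean2[of "norm x"] by auto
    then show ?thesis by blast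
  qed
  ultimately show ?thesis by simp
qed

section \<open>Approximation of almost every number with prescribed parities\<close>

definition odd_even_approx :: "real \<Rightarrow> real \<Rightarrow> int \<Rightarrow> nat \<Rightarrow> bool" where
  "odd_even_approx \<alpha> \<epsilon> P Q \<longleftrightarrow> 0 < Q \<and> even Q \<and> odd P \<and> coprime P (int Q) \<and> \<bar>real Q * \<alpha> - P\<bar> < \<epsilon> / Q"

text \<open>
  If the denominator of a Dirichlet approximation \<open>h / k\<close> is odd, one of the first two fractions
  \<open>(h' + m h) / (k' + m k)\<close>, where \<open>k' h - h' k = 1\<close>, has the required parities.
\<close>

lemma irrational_odd_even_approx:
  assumes "\<alpha> \<notin> \<rat>"
  shows "\<exists>P. \<exists>Q\<ge>N. odd_even_approx \<alpha> 13 P Q"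
proof -
  have "\<exists>h k. (h, k) \<in> approx_set \<alpha> \<and> int N < k"
    using infinite_approx_set rational_iff_finite_approx_set assms by blast
  then obtain h k where hk: "0 < k" "int N < k" "coprime h k" "\<bar>\<alpha> - h / k\<bar> < 1 / k\<^sup>2"
    by (auto simp: approx_set_def)
  have e1: "\<bar>k * \<alpha> - h\<bar> < 1 / k"
  proof -
    have "\<bar>k * \<alpha> - h\<bar> = k * \<bar>\<alpha> - h / k\<bar>" using hk(1) by (simp add: abs_if field_simps)
    also have "\<dots> < k * (1 / k\<^sup>2)" using hk by (intro mult_strict_left_mono) auto
    finally show ?thesis using hk(1) by (simp add: power2_eq_square)
  qed
  show ?thesis
  proof (cases "even k")
    case True
    then have "odd h" using hk(3) by (metis coprime_common_divisor odd_one)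
    moreover have "1 / real_of_int k \<le> 13 / real_of_int k" using hk(1) by (simp add: divide_right_mono)
    ultimately show ?thesis
      using hk True e1 by (intro exI[of _ h] exI[of _ "nat k"]) (auto simp: odd_even_approx_def even_nat_iff)
  next
    case False
    obtain u where u: "[h * u = 1] (mod k)" using cong_solve_coprime_int[OF hk(3)] by blast
    define k' where "k' = u mod k"
    have "[h * k' = 1] (mod k)" using u by (simp add: k'_def cong_def mod_mult_right_eq)
    then obtain h' where h': "h * k' - 1 = k * h'" by (auto simp: cong_iff_dvd_diff)
    have k'_range: "0 \<le> k'" "k' < k" using hk(1) by (auto simp: k'_def)
    \<comment> \<open>As \<open>k\<close> is odd, adding it once flips the parity of
      \<open>k'\<close>, adding it twice keeps it; the choice makes \<open>K\<close> even and keeps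
      it between \<open>k\<close> and \<open>3 * k\<close>.\<close>
    define m :: int where "m = (if even k' then 2 else 1)"
    define K where "K = k' + m * k"
    define H where "H = h' + m * h"
    have m: "1 \<le> m" "m \<le> 2" by (auto simp: m_def)
    have "k \<le> m * k" "m * k \<le> 2 * k" using m hk(1) by (auto simp: mult_right_mono)
    then have K: "k \<le> K" "K \<le> 3 * k" using k'_range unfolding K_def by linarith+
    have evenK: "even K" using False by (auto simp: K_def m_def)
    have det: "h * K - H * k = 1" using h' by (simp add: K_def H_def algebra_simps)
    then have oddH: "odd H" using evenK by (metis dvd_diff dvd_mult dvd_mult2 odd_one)
    have cop: "coprime H K"
    proof (rule coprimeI)
      fix c assume "c dvd H" "c dvd K"
      then have "c dvd h * K - H * k" by simp
      then show "is_unit c" using det by simp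
    qed
    \<comment> \<open>The unit determinant transfers the error of \<open>h / k\<close> to
      \<open>H / K\<close>: \<open>k * \<bar>K * \<alpha> - H\<bar>\<close> is at most
      \<open>3 + 1\<close>, and \<open>K \<le> 3 * k\<close> yields the product 12, below the strict
      bound 13.\<close>
    have "k * (K * \<alpha> - H) = K * (k * \<alpha> - h) + (h * K - H * k)" by (simp add: algebra_simps)
    then have "\<bar>k * (K * \<alpha> - H)\<bar> \<le> K * \<bar>k * \<alpha> - h\<bar> + 1"
      unfolding det using K hk(1) abs_triangle_ineq[of "K * (k * \<alpha> - h)" 1] by (simp add: abs_mult)
    also have "\<dots> \<le> 3 * k * (1 / k) + 1"
      using K hk(1) e1 by (intro add_mono mult_mono) auto
    also have "\<dots> = 4" using hk(1) by simp
    finally have "k * \<bar>K * \<alpha> - H\<bar> \<le> 4" using hk(1) by (simp add: abs_mult)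
    then have "K * \<bar>K * \<alpha> - H\<bar> \<le> 12"
      using K hk(1) mult_right_mono[of "real_of_int K" "3 * real_of_int k" "\<bar>K * \<alpha> - H\<bar>"] by auto
    then have "K * \<bar>K * \<alpha> - H\<bar> < 13" by linarith
    then have "\<bar>K * \<alpha> - H\<bar> < 13 / K" using K hk(1) by (simp add: pos_less_divide_eq mult.commute)
    then show ?thesis
      using K hk evenK oddH cop
      by (intro exI[of _ H] exI[of _ "nat K"]) (auto simp: odd_even_approx_def even_nat_iff)
  qed
qed

text \<open>If \<open>c = P / Q\<close> approximates an irrational \<open>x\<close> to within
  \<open>13 / Q^2\<close>, the interval of radius \<open>\<epsilon> / Q^2\<close> about
  \<open>c\<close> lies in the ball of radius \<open>28 / Q^2\<close> about \<open>x\<close>, and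
  all its points are approximated with constant \<epsilon> by the same fraction. The exceptional set
  thus misses the proportion \<open>\<epsilon> / 28\<close> of arbitrarily small balls about each of
  its irrational points.\<close>

lemma negligible_not_odd_even_approx_fixed:
  assumes "0 < \<epsilon>" "\<epsilon> < 1"
  shows "negligible {\<alpha>. \<not> (\<exists>P. \<exists>Q\<ge>N. odd_even_approx \<alpha> \<epsilon> P Q)}" (is "negligible ?S")
proof -
  have "negligible (?S - \<rat>)"
  proof (rule negligible_if_upper_density_less_one[where \<theta> = "1 - \<epsilon> / 28"])
    fix x r :: real assume x: "x \<in> ?S - \<rat>" and "r > 0"
    obtain n where n: "28 / r < real n" using reals_Archimedean2 by blast
    then have n': "28 / real n < r" using \<open>r > 0\<close>
      by (metis divide_pos_pos less_trans mult.commute pos_divide_less_eq zero_less_numeral)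
    obtain P Q where PQ: "Q \<ge> max N (max 1 n)" "odd_even_approx x 13 P Q"
      using irrational_odd_even_approx x by blast
    have Q: "1 \<le> real Q" "real n \<le> real Q" "N \<le> Q" "Q > 0" using PQ(1) by auto
    define d where "d = 28 / (real Q)\<^sup>2"
    define c where "c = P / real Q"
    define s where "s = \<epsilon> / (real Q)\<^sup>2"
    have "n > 0" using n \<open>r > 0\<close> by (metis divide_pos_pos less_trans of_nat_0_less_iff zero_less_numeral)
    have "d \<le> 28 / real n"
    proof -
      have "real n \<le> (real Q)\<^sup>2" using Q
        by (metis mult.right_neutral mult_mono of_nat_0_le_iff power2_eq_square zero_le_one)
      then show ?thesis unfolding d_def using \<open>n > 0\<close> by (intro divide_left_mono) (auto simp: Q)
    qed
    then have d: "0 < d" "d < r" using n' Q by (auto simp: d_def)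
    have scale: "\<bar>real Q * y - P\<bar> = real Q * \<bar>y - c\<bar>" for y
      using Q(4) by (simp add: c_def abs_if field_simps)
    have xc: "\<bar>x - c\<bar> < 13 / (real Q)\<^sup>2"
    proof -
      have "real Q * \<bar>x - c\<bar> < 13 / Q" using PQ(2) unfolding odd_even_approx_def scale by blast
      then show ?thesis using Q(4) by (simp add: field_simps power2_eq_square)
    qed
    have sub: "{c - s<..<c + s} \<subseteq> {x - d..x + d}"
    proof -
      have "s \<le> 1 / (real Q)\<^sup>2" using assms by (simp add: s_def divide_right_mono)
      moreover have "13 / (real Q)\<^sup>2 + 1 / (real Q)\<^sup>2 \<le> d"
        unfolding d_def add_divide_distrib[symmetric] by (intro divide_right_mono) auto
      ultimately have "\<bar>x - c\<bar> + s \<le> d" using xc by linarith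
      then show ?thesis by auto
    qed
    have avoid: "?S \<inter> {c - s<..<c + s} = {}"
    proof -
      have "y \<notin> ?S" if "\<bar>y - c\<bar> < s" for y
      proof -
        have "real Q * \<bar>y - c\<bar> < real Q * s" using that Q(4) by simp
        also have "\<dots> = \<epsilon> / Q" using Q(4) by (simp add: s_def power2_eq_square)
        finally have "odd_even_approx y \<epsilon> P Q"
          using PQ(2) scale[of y] by (simp add: odd_even_approx_def)
        then show ?thesis using Q(3) by auto
      qed
      then show ?thesis by (fastforce simp: abs_less_iff)
    qed
    have s: "s > 0" using assms Q by (simp add: s_def)
    show "\<exists>d U. 0 < d \<and> d < r \<and> (?S - \<rat>) \<inter> cball x d \<subseteq> U \<and> U \<in> lmeasurable \<and>
        measure lebesgue U \<le> (1 - \<epsilon> / 28) * measure lebesgue (cball x d)"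
    proof (intro exI conjI)
      show "(?S - \<rat>) \<inter> cball x d \<subseteq> {x - d..x + d} - {c - s<..<c + s}"
        using avoid by (auto simp: cball_eq_atLeastAtMost)
      have io: "{c - s<..<c + s} \<in> lmeasurable" 
        by (metis lmeasurable_interval(2))
      have ic: "{x - d..x + d} \<in> lmeasurable" 
        by (metis lmeasurable_interval(1))
      show "{x - d..x + d} - {c - s<..<c + s} \<in> lmeasurable"
        using io ic by (intro fmeasurable.Diff)
      have "measure lebesgue ({x - d..x + d} - {c - s<..<c + s}) 
          = measure lebesgue {x - d..x + d} - measure lebesgue {c - s<..<c + s}"
        by (rule measurable_measure_Diff[OF ic _ sub]) (use io in auto)
      also have "\<dots> = 2 * d - 2 * s" using d s by simp
      also have "\<dots> = (1 - \<epsilon> / 28) * (2 * d)"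
      proof -
        have "\<epsilon> / 28 * (2 * d) = 2 * s" by (simp add: d_def s_def)
        then show ?thesis by (simp only: left_diff_distrib mult_1_left)
      qed
      also have "2 * d = measure lebesgue (cball x d)" using d by (simp add: cball_eq_atLeastAtMost)
      finally show "measure lebesgue ({x - d..x + d} - {c - s<..<c + s}) 
          \<le> (1 - \<epsilon> / 28) * measure lebesgue (cball x d)" by simp
    qed (use d in auto)
  qed (use assms in auto)
  moreover have "negligible (\<rat> :: real set)" 
    by (simp add: negligible_iff_null_sets null_sets_completionI countable_imp_null_set_lborel countable_rat)
  ultimately have "negligible ((?S - \<rat>) \<union> \<rat>)" by (rule negligible_Un)
  then show ?thesis by (rule negligible_subset) blast
qed

lemma negligible_not_odd_even_approx:
  "negligible {\<alpha>. \<not> (\<forall>\<epsilon>>0. \<forall>N. \<exists>P. \<exists>Q\<ge>N. odd_even_approx \<alpha> \<epsilon> P Q)}"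
proof -
  let ?B = "\<lambda>\<epsilon> N. {\<alpha>. \<not> (\<exists>P. \<exists>Q\<ge>N. odd_even_approx \<alpha> \<epsilon> P Q)}"
  have neg: "negligible (?B (1 / (real n + 2)) N)" for n N
    by (rule negligible_not_odd_even_approx_fixed) (auto simp: divide_simps)
  have "negligible (\<Union>p. ?B (1 / (real (fst p) + 2)) (snd p))"
    using neg by (intro negligible_countable_Union) (simp, blast)
  then show ?thesis
  proof (rule negligible_subset)
    show "{\<alpha>. \<not> (\<forall>\<epsilon>>0. \<forall>N. \<exists>P. \<exists>Q\<ge>N. odd_even_approx \<alpha> \<epsilon> P Q)}
        \<subseteq> (\<Union>p. ?B (1 / (real (fst p) + 2)) (snd p))"
    proof
      fix \<alpha> assume "\<alpha> \<in> {\<alpha>. \<not> (\<forall>\<epsilon>>0. \<forall>N. \<exists>P. \<exists>Q\<ge>N. odd_even_approx \<alpha> \<epsilon> P Q)}"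
      then obtain \<epsilon> N where e: "\<epsilon> > 0" "\<not> (\<exists>P. \<exists>Q\<ge>N. odd_even_approx \<alpha> \<epsilon> P Q)" by blast
      obtain n where n: "1 / \<epsilon> < real n" using reals_Archimedean2 by blast
      then have n': "1 / (real n + 2) < \<epsilon>" using \<open>\<epsilon> > 0\<close> by (simp add: field_simps)
      have "odd_even_approx \<alpha> \<epsilon> P Q" if "odd_even_approx \<alpha> (1 / (real n + 2)) P Q" for P Q
      proof -
        have "1 / (real n + 2) / Q \<le> \<epsilon> / Q" using n' by (intro divide_right_mono) auto
        then show ?thesis using that unfolding odd_even_approx_def by linarith
      qed
      then have "\<alpha> \<in> ?B (1 / (real (fst (n, N)) + 2)) (snd (n, N))" using e by auto
      then show "\<alpha> \<in> (\<Union>p. ?B (1 / (real (fst p) + 2)) (snd p))" by blast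
    qed
  qed
qed

section \<open>Shadowing of a rational rotation over a resonant period\<close>

text \<open>
  For \<open>(q + 1) Q\<close> steps, the orbits of \<open>\<phi>\<close> and of \<open>\<phi> + \<sigma>\<close> under the rotation by \<open>2 \<sigma>\<close>
  stay in the same cells of length \<open>1 / Q\<close> as the orbits of the rational rotation by \<open>P / Q\<close>
  that start in the cells with the numbers \<open>g\<close> and \<open>g'\<close>.
\<close>

definition resonant_itinerary :: "nat \<Rightarrow> real \<Rightarrow> real \<Rightarrow> int \<Rightarrow> nat \<Rightarrow> int \<Rightarrow> int \<Rightarrow> bool" where
  "resonant_itinerary q \<sigma> \<phi> P Q g g' \<longleftrightarrow> 0 < Q \<and> even Q \<and> odd P \<and> coprime P (int Q) \<and>
     (\<forall>k\<le>Suc q * Q.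
        g + int k * P < real Q * (\<phi> + 2 * real k * \<sigma>) \<and> real Q * (\<phi> + 2 * real k * \<sigma>) < g + int k * P + 1 \<and>
        g' + int k * P < real Q * (\<phi> + \<sigma> + 2 * real k * \<sigma>) \<and> real Q * (\<phi> + \<sigma> + 2 * real k * \<sigma>) < g' + int k * P + 1)"

text \<open>The unbounded \<open>Q\<close> later produces returns at arbitrarily late times.\<close>

definition resonant_phase :: "nat \<Rightarrow> real \<Rightarrow> real \<Rightarrow> bool" where
  "resonant_phase q \<sigma> \<phi> \<longleftrightarrow> (\<forall>N. \<exists>Q\<ge>N. \<exists>P g g'. resonant_itinerary q \<sigma> \<phi> P Q g g')"

text \<open>The bound does not involve \<open>Q\<close>: the number of relevant grid points is of
  order \<open>Q\<close>, and the interval about each has length \<open>2 * \<eta> / Q\<close>. This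
  allows \<open>Q\<close> to be chosen after \<eta>.\<close>

lemma near_grid_cover:
  fixes c R \<eta> :: real and Q :: nat
  assumes "0 < Q" "0 < \<eta>" "\<eta> < 1" "0 \<le> R"
  shows "\<exists>T. {\<phi> \<in> cball 0 R. \<nexists>g::int. g + \<eta> < real Q * (\<phi> + c) \<and> real Q * (\<phi> + c) < g + 1 - \<eta>} \<subseteq> T \<and>
     T \<in> lmeasurable \<and> measure lebesgue T \<le> (2 * (R + \<bar>c\<bar>) + 7) * (2 * \<eta>)"
proof -
  define M where "M = \<lceil>real Q * (R + \<bar>c\<bar>)\<rceil> + 1"
  define T where "T = (\<Union>m\<in>{-M..M}. cball (m / real Q - c) (\<eta> / Q))"
  have M: "0 \<le> M"
  proof -
    have "0 \<le> real Q * (R + \<bar>c\<bar>)" using assms by simp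
    then show ?thesis unfolding M_def by linarith
  qed
  have "{\<phi> \<in> cball 0 R. \<nexists>g::int. g + \<eta> < real Q * (\<phi> + c) \<and> real Q * (\<phi> + c) < g + 1 - \<eta>} \<subseteq> T"
  proof clarify
    fix \<phi> :: real
    assume \<phi>: "\<phi> \<in> cball 0 R" and no: "\<nexists>g::int. g + \<eta> < real Q * (\<phi> + c) \<and> real Q * (\<phi> + c) < g + 1 - \<eta>"
    define x where "x = real Q * (\<phi> + c)"
    have "\<bar>x\<bar> \<le> real Q * (R + \<bar>c\<bar>)"
      unfolding x_def abs_mult using \<phi> by (intro mult_mono) auto
    then have fl: "- M \<le> \<lfloor>x\<rfloor>" "\<lfloor>x\<rfloor> + 1 \<le> M" unfolding M_def by linarith+
    have nb: "\<not> (real_of_int \<lfloor>x\<rfloor> + \<eta> < x \<and> x < real_of_int \<lfloor>x\<rfloor> + 1 - \<eta>)" using no unfolding x_def by blast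
    have "\<exists>m\<in>{-M..M}. \<bar>x - m\<bar> \<le> \<eta>"
    proof (cases "x \<le> \<lfloor>x\<rfloor> + \<eta>")
      case True then show ?thesis using fl by (intro bexI[of _ "\<lfloor>x\<rfloor>"]) auto
    next
      case False
      with nb have "real_of_int \<lfloor>x\<rfloor> + 1 - \<eta> \<le> x" by simp
      moreover have "x \<le> real_of_int \<lfloor>x\<rfloor> + 1" by linarith
      ultimately show ?thesis using fl by (intro bexI[of _ "\<lfloor>x\<rfloor> + 1"]) (auto simp: abs_le_iff)
    qed
    then obtain m where m: "m \<in> {-M..M}" "\<bar>x - m\<bar> \<le> \<eta>" by blast
    have "\<bar>m / real Q - c - \<phi>\<bar> = \<bar>x - m\<bar> / Q"
      using assms(1) by (simp add: x_def abs_if field_simps)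
    also have "\<dots> \<le> \<eta> / Q" using m by (intro divide_right_mono) auto
    finally show "\<phi> \<in> T" using m unfolding T_def by (auto simp: dist_real_def)
  qed
  moreover have "T \<in> lmeasurable" unfolding T_def by (intro fmeasurable.finite_UN) auto
  moreover have "measure lebesgue T \<le> (2 * (R + \<bar>c\<bar>) + 7) * (2 * \<eta>)"
  proof -
    have "measure lebesgue T \<le> (\<Sum>m\<in>{-M..M}. measure lebesgue (cball (m / real Q - c) (\<eta> / Q)))"
      unfolding T_def by (rule measure_UNION_le) auto
    also have "\<dots> = (\<Sum>m\<in>{-M..M}. 2 * \<eta> / Q)"
      using assms by (intro sum.cong refl) (simp add: cball_eq_atLeastAtMost field_simps)
    also have "\<dots> = (2 * M + 1) * (2 * \<eta> / Q)" using M by simp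
    also have "\<dots> \<le> (real Q * (2 * (R + \<bar>c\<bar>) + 7)) * (2 * \<eta> / Q)"
    proof (rule mult_right_mono)
      have "M \<le> real Q * (R + \<bar>c\<bar>) + 2" unfolding M_def by linarith
      moreover have "1 \<le> real Q" using assms(1) by simp
      ultimately show "real_of_int (2 * M + 1) \<le> real Q * (2 * (R + \<bar>c\<bar>) + 7)" 
        by (simp add: distrib_left)
    qed (use assms in simp)
    also have "\<dots> = (2 * (R + \<bar>c\<bar>) + 7) * (2 * \<eta>)" using assms(1) by simp
    finally show ?thesis .
  qed
  ultimately show ?thesis by blast
qed

text \<open>Measured in cells, an error below \<open>\<eta> / Suc q / Q\<close> per step grows to at
  most \<eta> in \<open>Suc q * Q\<close> steps. If \<phi> and \<open>\<phi> + \<sigma>\<close> keep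
  the distance \<eta> from the cell boundaries, both orbits follow the rational rotation; the
  remaining phases in a ball have measure of order \<eta>.\<close>

lemma negligible_not_resonant_phase:
  assumes approx: "\<And>\<epsilon> N. \<epsilon> > 0 \<Longrightarrow> \<exists>P. \<exists>Q\<ge>N. odd_even_approx (2 * \<sigma>) \<epsilon> P Q"
  shows "negligible {\<phi>. \<not> resonant_phase q \<sigma> \<phi>}"
proof -
  let ?B = "\<lambda>N R. {\<phi> \<in> cball 0 R. \<not> (\<exists>Q\<ge>N. \<exists>P g g'. resonant_itinerary q \<sigma> \<phi> P Q g g')}"
  have neg: "negligible (?B N (real R))" for N R
    unfolding negligible_outer_le
  proof (intro allI impI)
    fix e :: real assume "e > 0"
    define D where "D = (2 * (real R + \<bar>0\<bar>) + 7) * 2 + (2 * (real R + \<bar>\<sigma>\<bar>) + 7) * 2"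
    have "D = 8 * real R + 4 * \<bar>\<sigma>\<bar> + 28" unfolding D_def by simp
    moreover have "0 \<le> 8 * real R + 4 * \<bar>\<sigma>\<bar>" by simp
    ultimately have "D > 0" by linarith
    define \<eta> where "\<eta> = min (1 / 2) (e / D)"
    have \<eta>: "0 < \<eta>" "\<eta> < 1" "D * \<eta> \<le> e"
      using \<open>e > 0\<close> \<open>D > 0\<close> by (auto simp: \<eta>_def min_def field_simps)
    obtain P Q where PQ: "Q \<ge> N" "odd_even_approx (2 * \<sigma>) (\<eta> / Suc q) P Q"
      using approx[of "\<eta> / Suc q" N] \<eta> by auto
    then have Q: "0 < Q" "even Q" "odd P" "coprime P (int Q)" "\<bar>real Q * (2 * \<sigma>) - P\<bar> < \<eta> / Suc q / Q"
      by (auto simp: odd_even_approx_def)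
    let ?G = "\<lambda>c. {\<phi> \<in> cball 0 (real R). \<nexists>g::int. g + \<eta> < real Q * (\<phi> + c) \<and> real Q * (\<phi> + c) < g + 1 - \<eta>}"
    obtain T0 where T0: "?G 0 \<subseteq> T0" "T0 \<in> lmeasurable" "measure lebesgue T0 \<le> (2 * (real R + \<bar>0\<bar>) + 7) * (2 * \<eta>)"
      using near_grid_cover[OF Q(1) \<eta>(1,2) of_nat_0_le_iff[of R], of 0] by blast
    obtain T1 where T1: "?G \<sigma> \<subseteq> T1" "T1 \<in> lmeasurable" "measure lebesgue T1 \<le> (2 * (real R + \<bar>\<sigma>\<bar>) + 7) * (2 * \<eta>)"
      using near_grid_cover[OF Q(1) \<eta>(1,2) of_nat_0_le_iff[of R], of \<sigma>] by blast
    have "?B N (real R) \<subseteq> ?G 0 \<union> ?G \<sigma>"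
    proof
      fix \<phi> assume \<phi>: "\<phi> \<in> ?B N (real R)"
      show "\<phi> \<in> ?G 0 \<union> ?G \<sigma>"
      proof (rule ccontr)
        assume "\<phi> \<notin> ?G 0 \<union> ?G \<sigma>"
        moreover have "\<phi> \<in> cball 0 (real R)" using \<phi> by blast
        ultimately have
          "\<exists>g::int. g + \<eta> < real Q * (\<phi> + 0) \<and> real Q * (\<phi> + 0) < g + 1 - \<eta>"
          "\<exists>g::int. g + \<eta> < real Q * (\<phi> + \<sigma>) \<and> real Q * (\<phi> + \<sigma>) < g + 1 - \<eta>" by blast+
        then obtain g g' :: int where g: "real_of_int g + \<eta> < real Q * \<phi>" "real Q * \<phi> < real_of_int g + 1 - \<eta>"
          "real_of_int g' + \<eta> < real Q * (\<phi> + \<sigma>)" "real Q * (\<phi> + \<sigma>) < real_of_int g' + 1 - \<eta>"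
          by (simp only: add_0_right) blast
        have small: "\<bar>real k * (real Q * (2 * \<sigma>) - P)\<bar> \<le> \<eta>" if "k \<le> Suc q * Q" for k
        proof -
          have "\<bar>real k * (real Q * (2 * \<sigma>) - P)\<bar> \<le> (real (Suc q) * real Q) * (\<eta> / Suc q / Q)"
          proof -
            have "real k \<le> real (Suc q) * real Q" using that by (simp only: of_nat_mult[symmetric] of_nat_le_iff)
            then show ?thesis unfolding abs_mult using Q(5) by (intro mult_mono) (auto simp del: of_nat_Suc)
          qed
          also have "\<dots> = \<eta>" using Q(1) by (simp del: of_nat_Suc add: of_nat_mult)
          finally show ?thesis .
        qed
        have "resonant_itinerary q \<sigma> \<phi> P Q g g'"
          unfolding resonant_itinerary_def
        proof (intro conjI allI impI)
          fix k assume "k \<le> Suc q * Q"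
          note sm = small[OF this, unfolded abs_le_iff]
          have e0: "real Q * (\<phi> + 2 * real k * \<sigma>) = real Q * \<phi> + real_of_int (int k * P) + real k * (real Q * (2 * \<sigma>) - P)"
            and e1: "real Q * (\<phi> + \<sigma> + 2 * real k * \<sigma>) = real Q * (\<phi> + \<sigma>) + real_of_int (int k * P) + real k * (real Q * (2 * \<sigma>) - P)"
            by (auto simp: algebra_simps)
          show "g + int k * P < real Q * (\<phi> + 2 * real k * \<sigma>)" "real Q * (\<phi> + 2 * real k * \<sigma>) < g + int k * P + 1"
            using g sm unfolding e0 by linarith+
          show "g' + int k * P < real Q * (\<phi> + \<sigma> + 2 * real k * \<sigma>)" "real Q * (\<phi> + \<sigma> + 2 * real k * \<sigma>) < g' + int k * P + 1"
            using g sm unfolding e1 by linarith+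
        qed (use Q in auto)
        then show False using \<phi> PQ(1) by blast
      qed
    qed
    then have "?B N (real R) \<subseteq> T0 \<union> T1" using T0(1) T1(1) by blast
    moreover have "T0 \<union> T1 \<in> lmeasurable" using T0 T1 by (intro fmeasurable.Un)
    moreover have "measure lebesgue (T0 \<union> T1) \<le> e"
    proof -
      have "measure lebesgue (T0 \<union> T1) \<le> measure lebesgue T0 + measure lebesgue T1"
        using T0 T1 by (intro measure_Un_le) auto
      also have "\<dots> \<le> D * \<eta>" using T0(3) T1(3) by (simp add: D_def algebra_simps)
      finally show ?thesis using \<eta>(3) by simp
    qed
    ultimately show "\<exists>T. ?B N (real R) \<subseteq> T \<and> T \<in> lmeasurable \<and> measure lebesgue T \<le> e" by blast
  qed
  have "negligible (\<Union>p. ?B (fst p) (real (snd p)))"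
    using neg by (intro negligible_countable_Union) (simp, blast)
  then show ?thesis
  proof (rule negligible_subset, intro subsetI)
    fix \<phi> assume "\<phi> \<in> {\<phi>. \<not> resonant_phase q \<sigma> \<phi>}"
    then obtain N where N: "\<not> (\<exists>Q\<ge>N. \<exists>P g g'. resonant_itinerary q \<sigma> \<phi> P Q g g')"
      by (auto simp: resonant_phase_def)
    obtain R where "\<bar>\<phi>\<bar> < real R" using reals_Archimedean2 by blast
    then have "\<phi> \<in> ?B (fst (N, R)) (real (snd (N, R)))" using N by auto
    then show "\<phi> \<in> (\<Union>p. ?B (fst p) (real (snd p)))" by blast
  qed
qed

section \<open>The collision map\<close>

locale accelerator =
  fixes A B T :: real
  assumes A_pos: "0 < A" and A_less_B: "A < B" and T_pos: "0 < T"
begin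

abbreviation "k \<equiv> wall_speed A B T"
abbreviation "l \<equiv> wall_dist A B T"
abbreviation "vel \<equiv> wall_vel A B T"
abbreviation "X \<equiv> phase_cylinder A B T"
abbreviation "F \<equiv> collision_map A B T"
abbreviation "hit \<equiv> next_time A B T"

lemma k_pos: "0 < k"
  using A_less_B T_pos by (simp add: wall_speed_def)

lemma k_T: "k * T = B - A"
  using T_pos by (simp add: wall_speed_def)

lemma rmod_period: "2 * real_of_int n * T \<le> t \<Longrightarrow> t < 2 * (real_of_int n + 1) * T \<Longrightarrow> t rmod (2 * T) = t - 2 * real_of_int n * T" for n :: int
  by (rule rmod_unique[of _ _ _ n]) (use T_pos in \<open>auto simp: algebra_simps\<close>)

lemma period_cell: "\<exists>n::int. 2 * real_of_int n * T \<le> t \<and> t < 2 * (real_of_int n + 1) * T"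
proof -
  define n where "n = \<lfloor>t / (2 * T)\<rfloor>"
  have "real_of_int n \<le> t / (2 * T)" "t / (2 * T) < real_of_int n + 1" unfolding n_def by linarith+
  then have "2 * real_of_int n * T \<le> t" "t < 2 * (real_of_int n + 1) * T"
    using T_pos by (simp_all add: pos_le_divide_eq pos_divide_less_eq mult_ac)
  then show ?thesis by blast
qed

lemma wall_dist_cell:
  fixes n :: int
  assumes "2 * real_of_int n * T \<le> t" "t \<le> 2 * (real_of_int n + 1) * T"
  shows "l t = A + k * \<bar>t - (2 * real_of_int n + 1) * T\<bar>"
proof (cases "t = 2 * (real_of_int n + 1) * T")
  case True
  then have "t rmod (2 * T) = 0"
    using rmod_self_multiple_int[of "n + 1" "2 * T"] by (simp add: algebra_simps)
  then have "l t = B" using T_pos by (simp add: wall_dist_def)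
  moreover have "t - (2 * real_of_int n + 1) * T = T" using True by (simp add: algebra_simps)
  ultimately show ?thesis using k_T T_pos by simp
next
  case False
  then have r: "t rmod (2 * T) = t - 2 * real_of_int n * T" using assms by (intro rmod_period) auto
  show ?thesis
  proof (cases "t - 2 * real_of_int n * T < T")
    case True
    then have "\<bar>t - (2 * real_of_int n + 1) * T\<bar> = T - (t - 2 * real_of_int n * T)" by (simp add: algebra_simps)
    then show ?thesis using True k_T unfolding wall_dist_def r by (simp add: Let_def right_diff_distrib)
  next
    case False
    then have "\<bar>t - (2 * real_of_int n + 1) * T\<bar> = t - 2 * real_of_int n * T - T" by (simp add: algebra_simps)
    then show ?thesis using False unfolding wall_dist_def r by (simp add: Let_def)
  qed
qed

lemma wall_vel_cell:
  fixes n :: int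
  assumes "2 * real_of_int n * T \<le> t" "t < 2 * (real_of_int n + 1) * T"
  shows "vel t = (if t \<le> (2 * real_of_int n + 1) * T then - k else k)"
  unfolding wall_vel_def rmod_period[OF assms] by (simp add: algebra_simps)

text \<open>Together with \<open>wall_dist_attained\<close> this presents \<open>l\<close> as the
  lower envelope of translates of one V-shaped graph. The Lipschitz bound then follows without
  comparing the pieces that contain two given times.\<close>

lemma wall_dist_le: "l t \<le> A + k * \<bar>t - (2 * real_of_int n + 1) * T\<bar>" for n :: int
proof -
  obtain m :: int where m: "2 * real_of_int m * T \<le> t" "t < 2 * (real_of_int m + 1) * T" using period_cell by blast
  have eq: "l t = A + k * \<bar>t - (2 * real_of_int m + 1) * T\<bar>" using m by (intro wall_dist_cell) auto
  have "\<bar>t - (2 * real_of_int m + 1) * T\<bar> \<le> \<bar>t - (2 * real_of_int n + 1) * T\<bar>"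
  proof (cases m n rule: linorder_cases)
    case less
    then have "(real_of_int m + 1) * T \<le> real_of_int n * T" using T_pos by (intro mult_right_mono) linarith+
    then show ?thesis using m by (simp add: algebra_simps abs_le_iff)
  next
    case greater
    then have "(real_of_int n + 1) * T \<le> real_of_int m * T" using T_pos by (intro mult_right_mono) linarith+
    then show ?thesis using m by (simp add: algebra_simps abs_le_iff)
  qed simp
  then show ?thesis unfolding eq using k_pos by simp
qed

lemma wall_dist_attained: "\<exists>n::int. l t = A + k * \<bar>t - (2 * real_of_int n + 1) * T\<bar>"
proof -
  obtain n :: int where "2 * real_of_int n * T \<le> t" "t < 2 * (real_of_int n + 1) * T" using period_cell by blast
  then show ?thesis by (intro exI[of _ n] wall_dist_cell) auto
qed

lemma wall_dist_lipschitz: "\<bar>l t - l s\<bar> \<le> k * \<bar>t - s\<bar>"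
proof -
  have one: "l t - l s \<le> k * \<bar>t - s\<bar>" for t s
  proof -
    obtain n :: int where n: "l s = A + k * \<bar>s - (2 * real_of_int n + 1) * T\<bar>" using wall_dist_attained by blast
    have "l t - l s \<le> k * (\<bar>t - (2 * real_of_int n + 1) * T\<bar> - \<bar>s - (2 * real_of_int n + 1) * T\<bar>)"
      using wall_dist_le[of t n] n by (simp add: algebra_simps)
    also have "\<dots> \<le> k * \<bar>t - s\<bar>" using k_pos by (intro mult_left_mono) auto
    finally show ?thesis .
  qed
  show ?thesis using one[of t s] one[of s t] by (simp add: abs_le_iff abs_minus_commute)
qed

lemma wall_dist_ge: "A \<le> l t"
  using wall_dist_attained[of t] k_pos by auto

lemma wall_dist_pos: "0 < l t"
  using wall_dist_ge[of t] A_pos by simp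

lemma wall_dist_le_B: "l t \<le> B"
proof -
  obtain n :: int where n: "2 * real_of_int n * T \<le> t" "t < 2 * (real_of_int n + 1) * T" using period_cell by blast
  then have "\<bar>t - (2 * real_of_int n + 1) * T\<bar> \<le> T" by (simp add: abs_le_iff algebra_simps)
  then have "k * \<bar>t - (2 * real_of_int n + 1) * T\<bar> \<le> k * T" using k_pos by simp
  then show ?thesis using wall_dist_cell[of n t] n k_T by simp
qed

lemma wall_dist_periodic: "l (t + 2 * real_of_int n * T) = l t" for n :: int
proof -
  obtain m :: int where m: "2 * real_of_int m * T \<le> t" "t < 2 * (real_of_int m + 1) * T" using period_cell by blast
  have "l (t + 2 * real_of_int n * T) = A + k * \<bar>t + 2 * real_of_int n * T - (2 * real_of_int (m + n) + 1) * T\<bar>"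
    using wall_dist_cell[of "m + n" "t + 2 * real_of_int n * T"] m by (simp add: algebra_simps)
  also have "\<dots> = l t" using wall_dist_cell[of m t] m by (simp add: algebra_simps)
  finally show ?thesis .
qed

lemma wall_vel_periodic: "vel (t + 2 * real_of_int n * T) = vel t" for n :: int
proof -
  obtain m :: int where m: "2 * real_of_int m * T \<le> t" "t < 2 * (real_of_int m + 1) * T" using period_cell by blast
  then show ?thesis
    using wall_vel_cell[of "m + n" "t + 2 * real_of_int n * T"] wall_vel_cell[of m t] by (simp add: algebra_simps)
qed

lemma rmod_shift: "\<exists>n::int. t rmod (2 * T) = t + 2 * real_of_int n * T"
  by (rule exI[of _ "- \<lfloor>t / (2 * T)\<rfloor>"]) (use T_pos in \<open>simp add: rmod_def\<close>)

lemma wall_vel_rmod [simp]: "vel (t rmod (2 * T)) = vel t"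
  by (simp add: wall_vel_def)

lemma wall_vel_cases: "vel t = k \<or> vel t = - k"
  by (simp add: wall_vel_def)

lemma continuous_wall_dist [continuous_intros]: "continuous_on S l"
proof (rule lipschitz_on_continuous_on)
  show "k-lipschitz_on S l"
    using k_pos wall_dist_lipschitz by (intro lipschitz_onI) (auto simp: dist_real_def)
qed

text \<open>At a corner \<open>2 * n * T\<close> the left slope is \<open>k\<close> while
  \<open>vel t\<close> is \<open>- k\<close>; at all other times they agree. The inequality makes
  every impact strictly faster than \<open>vel\<close>.\<close>

lemma wall_dist_left_slope:
  "\<exists>d>0. \<exists>\<rho>\<ge>vel t. \<forall>s. t - d < s \<and> s < t \<longrightarrow> l s = l t - \<rho> * (t - s)"
proof -
  obtain n :: int where n: "2 * real_of_int n * T \<le> t" "t < 2 * (real_of_int n + 1) * T" using period_cell by blast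
  consider "t = 2 * real_of_int n * T" | "2 * real_of_int n * T < t" "t \<le> (2 * real_of_int n + 1) * T" | "(2 * real_of_int n + 1) * T < t"
    using n by linarith
  then show ?thesis
  proof cases
    case 1
    have "l s = l t - k * (t - s)" if "t - T < s" "s < t" for s
      using wall_dist_cell[of "n - 1" s] wall_dist_cell[of "n - 1" t] that 1 T_pos
      by (simp add: algebra_simps)
    then show ?thesis using T_pos wall_vel_cases[of t] k_pos by (intro exI[of _ T] conjI exI[of _ k]) auto
  next
    case 2
    have "l s = l t - (- k) * (t - s)" if "t - (t - 2 * real_of_int n * T) < s" "s < t" for s
      using wall_dist_cell[of n s] wall_dist_cell[of n t] that 2 n
      by (simp add: algebra_simps)
    moreover have "vel t = - k" using wall_vel_cell[OF n] 2 by simp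
    ultimately show ?thesis using 2 by (intro exI[of _ "t - 2 * real_of_int n * T"] conjI exI[of _ "- k"]) auto
  next
    case 3
    have "l s = l t - k * (t - s)" if "t - (t - (2 * real_of_int n + 1) * T) < s" "s < t" for s
      using wall_dist_cell[of n s] wall_dist_cell[of n t] that 3 n T_pos
      by (simp add: algebra_simps)
    moreover have "vel t = k" using wall_vel_cell[OF n] 3 by simp
    ultimately show ?thesis using 3 by (intro exI[of _ "t - (2 * real_of_int n + 1) * T"] conjI exI[of _ k]) auto
  qed
qed

text \<open>At a corner \<open>(2 * n + 1) * T\<close> the right slope exceeds \<open>vel t\<close>,
  so a state of the phase cylinder moves strictly inside even at corners. Equality off the corners
  serves the transversality of impacts.\<close>

lemma wall_dist_right_slope:
  "\<exists>d>0. \<exists>\<rho>\<ge>vel t. ((\<forall>n::int. t \<noteq> real_of_int n * T) \<longrightarrow> \<rho> = vel t) \<and> (\<forall>s. t < s \<and> s < t + d \<longrightarrow> l s = l t + \<rho> * (s - t))"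
proof -
  obtain n :: int where n: "2 * real_of_int n * T \<le> t" "t < 2 * (real_of_int n + 1) * T" using period_cell by blast
  consider "t < (2 * real_of_int n + 1) * T" | "t \<ge> (2 * real_of_int n + 1) * T" by linarith
  then show ?thesis
  proof cases
    case 1
    have "l s = l t + (- k) * (s - t)" if "t < s" "s < t + ((2 * real_of_int n + 1) * T - t)" for s
      using wall_dist_cell[of n s] wall_dist_cell[of n t] that 1 n T_pos
      by (simp add: algebra_simps)
    moreover have "vel t = - k" using wall_vel_cell[OF n] 1 by simp
    ultimately show ?thesis using 1 by (intro exI[of _ "(2 * real_of_int n + 1) * T - t"] conjI exI[of _ "- k"]) auto
  next
    case 2
    have "l s = l t + k * (s - t)" if "t < s" "s < t + (2 * (real_of_int n + 1) * T - t)" for s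
      using wall_dist_cell[of n s] wall_dist_cell[of n t] that 2 n T_pos
      by (simp add: algebra_simps)
    moreover have "vel t = k" if "\<forall>n::int. t \<noteq> real_of_int n * T"
      using wall_vel_cell[OF n] 2 that[rule_format, of "2 * n + 1"] by simp
    ultimately show ?thesis using n k_pos wall_vel_cases[of t]
      by (intro exI[of _ "2 * (real_of_int n + 1) * T - t"] conjI exI[of _ k]) auto
  qed
qed

lemma phase_cylinder_iff: "(t, v) \<in> X \<longleftrightarrow> 0 \<le> t \<and> t < 2 * T \<and> - vel t < v"
  by (simp add: phase_cylinder_def)

section \<open>The flight between two collisions\<close>

abbreviation "pdist t0 v0 t \<equiv> \<bar>l t0 - v0 * (t - t0)\<bar>"

lemma particle_dist_eq: "particle_dist A B T (t0, v0) t = pdist t0 v0 t"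
  by (simp add: particle_dist_def)

lemma initially_inside:
  assumes "- vel t0 < v0"
  shows "\<exists>d>0. \<forall>t. t0 < t \<and> t < t0 + d \<longrightarrow> pdist t0 v0 t < l t"
proof -
  obtain d \<rho> where d: "d > 0" "\<rho> \<ge> vel t0" "\<And>s. t0 < s \<Longrightarrow> s < t0 + d \<Longrightarrow> l s = l t0 + \<rho> * (s - t0)"
    using wall_dist_right_slope[of t0] by metis
  \<comment> \<open>Before \<open>l t0 / (\<bar>v0\<bar> + 1)\<close> has elapsed the particle
    cannot reach the fixed wall, so the absolute value has a known sign.\<close>
  define d' where "d' = min d (l t0 / (\<bar>v0\<bar> + 1))"
  have "d' > 0" using d wall_dist_pos[of t0] by (simp add: d'_def)
  moreover have "pdist t0 v0 t < l t" if "t0 < t" "t < t0 + d'" for t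
  proof -
    have "(t - t0) * (\<bar>v0\<bar> + 1) < l t0"
      using that by (simp add: d'_def pos_less_divide_eq[symmetric])
    moreover have "v0 * (t - t0) \<le> \<bar>v0\<bar> * (t - t0)" using that by (intro mult_right_mono) auto
    ultimately have "v0 * (t - t0) < l t0" using that by (simp add: algebra_simps)
    then have "pdist t0 v0 t = l t0 - v0 * (t - t0)" by simp
    also have "\<dots> < l t0 + \<rho> * (t - t0)"
      using mult_strict_right_mono[of "- v0" \<rho> "t - t0"] assms d(2) that by simp
    also have "\<dots> = l t" using d(3) that by (simp add: d'_def)
    finally show ?thesis .
  qed
  ultimately show ?thesis by blast
qed

text \<open>A particle at rest is on the wall again after one period. The path of a moving one,
  extended freely, eventually exceeds the largest distance \<open>B\<close>, and the intermediate
  value theorem applies.\<close>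

lemma wall_hit_again:
  assumes z: "(t0, v0) \<in> X"
  shows "\<exists>t>t0. pdist t0 v0 t = l t"
proof (cases "v0 = 0")
  case True
  have "pdist t0 v0 (t0 + 2 * T) = l (t0 + 2 * T)"
    using True wall_dist_periodic[of t0 1] wall_dist_pos[of t0] by simp
  then show ?thesis using T_pos by (intro exI[of _ "t0 + 2 * T"]) auto
next
  case False
  obtain d where d: "d > 0" "\<And>t. t0 < t \<Longrightarrow> t < t0 + d \<Longrightarrow> pdist t0 v0 t < l t"
    using initially_inside z phase_cylinder_iff by meson
  define b where "b = t0 + d + 2 * B / \<bar>v0\<bar>"
  have B: "B > 0" using A_pos A_less_B by simp
  have "2 * B \<le> \<bar>v0 * (b - t0)\<bar>"
  proof -
    have "2 * B = \<bar>v0\<bar> * (2 * B / \<bar>v0\<bar>)" using False by simp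
    also have "\<dots> \<le> \<bar>v0\<bar> * \<bar>b - t0\<bar>" using d(1) B by (intro mult_left_mono) (auto simp: b_def)
    finally show ?thesis by (simp add: abs_mult)
  qed
  then have "B \<le> pdist t0 v0 b" using wall_dist_le_B[of t0] wall_dist_pos[of t0] by linarith
  then have big: "l b \<le> pdist t0 v0 b" using wall_dist_le_B[of b] by linarith
  have "\<exists>x\<ge>t0 + d / 2. x \<le> b \<and> pdist t0 v0 x - l x = 0"
  proof (rule IVT')
    show "pdist t0 v0 (t0 + d / 2) - l (t0 + d / 2) \<le> 0" using d(1) d(2)[of "t0 + d / 2"] by simp
    show "t0 + d / 2 \<le> b" using d(1) B by (simp add: b_def)
  qed (use big in \<open>auto intro!: continuous_intros\<close>)
  then obtain x where "t0 + d / 2 \<le> x" "pdist t0 v0 x - l x = 0" by blast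
  then show ?thesis using d(1) by (intro exI[of _ x]) auto
qed

lemma next_time_eq: "hit (t0, v0) = Inf {t. t0 < t \<and> pdist t0 v0 t = l t}"
  by (simp add: next_time_def particle_dist_eq)

text \<open>The later meetings stay a positive distance away from \<open>t0\<close> and form a
  closed set, so the infimum is attained. Being on or beyond the wall before that would give an
  earlier meeting by the intermediate value theorem.\<close>

lemma next_time_hit:
  assumes z: "(t0, v0) \<in> X"
  shows next_time_gt: "t0 < hit (t0, v0)"
    and next_time_dist: "pdist t0 v0 (hit (t0, v0)) = l (hit (t0, v0))"
    and inside_before_next_time: "\<And>t. t0 < t \<Longrightarrow> t < hit (t0, v0) \<Longrightarrow> pdist t0 v0 t < l t"
proof -
  let ?S = "{t. t0 < t \<and> pdist t0 v0 t = l t}"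
  obtain d where d: "d > 0" "\<And>t. t0 < t \<Longrightarrow> t < t0 + d \<Longrightarrow> pdist t0 v0 t < l t"
    using initially_inside z phase_cylinder_iff by meson
  have S: "?S = {t0 + d..} \<inter> {t. pdist t0 v0 t = l t}" using d by force
  have "closed ?S" unfolding S
    by (intro closed_Int closed_Collect_eq continuous_intros closed_real_atLeast)
  moreover have bdd: "bdd_below ?S" by (rule bdd_belowI[of _ t0]) auto
  ultimately have "hit (t0, v0) \<in> ?S"
    unfolding next_time_eq using wall_hit_again[OF z] by (intro closed_contains_Inf) auto
  then show "t0 < hit (t0, v0)" "pdist t0 v0 (hit (t0, v0)) = l (hit (t0, v0))" by auto
  fix t assume t: "t0 < t" "t < hit (t0, v0)"
  have lower: "hit (t0, v0) \<le> s" if "t0 < s" "pdist t0 v0 s = l s" for s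
    unfolding next_time_eq using that bdd by (intro cInf_lower) auto
  show "pdist t0 v0 t < l t"
  proof (rule ccontr)
    assume "\<not> pdist t0 v0 t < l t"
    define a where "a = min t (t0 + d / 2)"
    have a: "t0 < a" "a \<le> t" "a < t0 + d" using t d(1) by (auto simp: a_def)
    have "\<exists>x\<ge>a. x \<le> t \<and> pdist t0 v0 x - l x = 0"
    proof (rule IVT')
      show "pdist t0 v0 a - l a \<le> 0" using a d(2)[of a] by simp
    qed (use a \<open>\<not> pdist t0 v0 t < l t\<close> in \<open>auto intro!: continuous_intros\<close>)
    then obtain x where "a \<le> x" "x \<le> t" "pdist t0 v0 x = l x" by auto
    then show False using lower[of x] a t by simp
  qed
qed

lemma next_time_le: "(t0, v0) \<in> X \<Longrightarrow> t0 < t \<Longrightarrow> l t \<le> pdist t0 v0 t \<Longrightarrow> hit (t0, v0) \<le> t"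
  using inside_before_next_time[of t0 v0 t] by force

lemma next_time_unique:
  assumes "(t0, v0) \<in> X" "t0 < t1" "pdist t0 v0 t1 = l t1"
    "\<And>t. t0 < t \<Longrightarrow> t < t1 \<Longrightarrow> pdist t0 v0 t \<noteq> l t"
  shows "hit (t0, v0) = t1"
  using assms next_time_le[of t0 v0 t1] next_time_dist[OF assms(1)] next_time_gt[OF assms(1)] by force

definition impact_velocity :: "real \<times> real \<Rightarrow> real" where
  "impact_velocity = (\<lambda>(t0, v0). if l t0 < v0 * (hit (t0, v0) - t0) then v0 else - v0)"

lemma collision_map_eq:
  "F z = (hit z rmod (2 * T), impact_velocity z - 2 * vel (hit z))"
  by (cases z) (simp add: collision_map_def impact_velocity_def Let_def)

text \<open>Time reversal: moment and velocity of the impact determine the whole path, by one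
  formula whether or not the fixed wall was hit. Injectivity of the collision map and transversality
  of impacts rest on it.\<close>

lemma flight_backwards:
  assumes "(t0, v0) \<in> X"
  shows "pdist t0 v0 t = \<bar>l (hit (t0, v0)) - impact_velocity (t0, v0) * (hit (t0, v0) - t)\<bar>"
proof (cases "l t0 < v0 * (hit (t0, v0) - t0)")
  case True
  then have "l (hit (t0, v0)) = v0 * (hit (t0, v0) - t0) - l t0"
    using next_time_dist[OF assms] by simp
  then show ?thesis using True by (simp add: impact_velocity_def abs_minus_commute algebra_simps)
next
  case False
  then have "l (hit (t0, v0)) = l t0 - v0 * (hit (t0, v0) - t0)"
    using next_time_dist[OF assms] by simp
  then show ?thesis using False by (simp add: impact_velocity_def algebra_simps)
qed

lemma impact_velocity_gt:
  assumes "(t0, v0) \<in> X"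
  shows "vel (hit (t0, v0)) < impact_velocity (t0, v0)"
proof -
  let ?h = "hit (t0, v0)" and ?u = "impact_velocity (t0, v0)"
  obtain d \<rho> where d: "d > 0" "\<rho> \<ge> vel ?h" "\<And>s. ?h - d < s \<Longrightarrow> s < ?h \<Longrightarrow> l s = l ?h - \<rho> * (?h - s)"
    using wall_dist_left_slope[of ?h] by metis
  define e where "e = min (d / 2) ((?h - t0) / 2)"
  have e: "0 < e" "e < d" "e < ?h - t0"
    using d(1) next_time_gt[OF assms] by (auto simp: e_def min_def)
  have "\<bar>l ?h - ?u * e\<bar> < l (?h - e)"
    using inside_before_next_time[OF assms, of "?h - e"] flight_backwards[OF assms, of "?h - e"] e by simp
  moreover have "l (?h - e) = l ?h - \<rho> * e" using d(3)[of "?h - e"] e by simp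
  ultimately have "\<rho> * e < ?u * e" by linarith
  then show ?thesis using e d(2) by simp
qed

lemma collision_map_in_phase_cylinder:
  assumes "z \<in> X"
  shows "F z \<in> X"
proof -
  obtain t0 v0 where z: "z = (t0, v0)" by (cases z)
  have "0 \<le> hit z rmod (2 * T)" "hit z rmod (2 * T) < 2 * T"
    using T_pos by (auto intro!: rmod_nonneg rmod_less)
  then show ?thesis
    using impact_velocity_gt[of t0 v0] assms unfolding z collision_map_eq phase_cylinder_iff by simp
qed

text \<open>Equal images give the same backward path up to a shift by periods. If one flight started
  later than the other, the other would touch the wall at that moment, in the middle of a flight
  that is strictly inside. The integer \<open>n\<close> accounts for times being recorded modulo
  \<open>2 * T\<close>.\<close>

lemma inj_on_collision_map: "inj_on F X"
proof -
  have earlier: "t0 \<le> t0' + 2 * real_of_int n * T"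
    if X: "(t0, v0) \<in> X" "(t0', v0') \<in> X"
      and hit: "hit (t0, v0) = hit (t0', v0') + 2 * real_of_int n * T"
      and imp: "impact_velocity (t0, v0) = impact_velocity (t0', v0')"
    for t0 v0 t0' v0' and n :: int
  proof (rule ccontr)
    assume "\<not> t0 \<le> t0' + 2 * real_of_int n * T"
    then have "t0' < t0 - 2 * real_of_int n * T" by simp
    moreover have "t0 - 2 * real_of_int n * T < hit (t0', v0')" using next_time_gt[OF X(1)] hit by simp
    ultimately have "pdist t0' v0' (t0 - 2 * real_of_int n * T) < l (t0 - 2 * real_of_int n * T)"
      by (rule inside_before_next_time[OF X(2)])
    moreover have "pdist t0' v0' (t0 - 2 * real_of_int n * T) = pdist t0 v0 t0"
      unfolding flight_backwards[OF X(1)] flight_backwards[OF X(2)] imp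
      using hit wall_dist_periodic[of "hit (t0', v0')" n] by (simp add: algebra_simps)
    moreover have "l (t0 - 2 * real_of_int n * T) = l t0"
      using wall_dist_periodic[of t0 "- n"] by simp
    ultimately show False using wall_dist_pos[of t0] by simp
  qed
  show ?thesis
  proof (rule inj_onI)
    fix z z' assume X: "z \<in> X" "z' \<in> X" and eq: "F z = F z'"
    obtain t0 v0 t0' v0' where z: "z = (t0, v0)" "z' = (t0', v0')" by (cases z, cases z')
    have r: "hit z rmod (2 * T) = hit z' rmod (2 * T)"
      and u: "impact_velocity z - 2 * vel (hit z) = impact_velocity z' - 2 * vel (hit z')"
      using eq by (auto simp: collision_map_eq)
    have imp: "impact_velocity z = impact_velocity z'"
      using u wall_vel_rmod[of "hit z"] wall_vel_rmod[of "hit z'"] unfolding r by simp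
    obtain m m' :: int where "hit z rmod (2 * T) = hit z + 2 * real_of_int m * T" "hit z' rmod (2 * T) = hit z' + 2 * real_of_int m' * T"
      using rmod_shift by meson
    then have hit: "hit z = hit z' + 2 * real_of_int (m' - m) * T" "hit z' = hit z + 2 * real_of_int (m - m') * T"
      using r by (auto simp: algebra_simps)
    have "t0 \<le> t0' + 2 * real_of_int (m' - m) * T"
      by (rule earlier[OF X[unfolded z] hit(1)[unfolded z] imp[unfolded z]])
    moreover have "t0' \<le> t0 + 2 * real_of_int (m - m') * T"
      by (rule earlier[OF X(2,1)[unfolded z] hit(2)[unfolded z] imp[unfolded z, symmetric]])
    moreover have "2 * real_of_int (m - m') * T = - (2 * real_of_int (m' - m) * T)" by (simp add: algebra_simps)
    ultimately have t: "t0 = t0' + 2 * real_of_int (m' - m) * T" by linarith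
    have range: "0 \<le> t0" "t0 < 2 * T" "0 \<le> t0'" "t0' < 2 * T" using X by (auto simp: z phase_cylinder_iff)
    have "m' = m"
    proof (rule ccontr)
      assume "m' \<noteq> m"
      then consider "1 \<le> m' - m" | "m' - m \<le> - 1" by linarith
      then show False
      proof cases
        case 1
        then have "1 * T \<le> real_of_int (m' - m) * T" using T_pos by (intro mult_right_mono) linarith+
        then show False using t range by linarith
      next
        case 2
        then have "real_of_int (m' - m) * T \<le> (- 1) * T" using T_pos by (intro mult_right_mono) linarith+
        then show False using t range by linarith
      qed
    qed
    then have t: "t0 = t0'" and h: "hit z = hit z'" using t hit by auto
    have same: "pdist t0 v0 s = pdist t0 v0' s" for s
      using flight_backwards[of t0 v0 s] flight_backwards[of t0' v0' s] X h imp unfolding z t by simp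
    have "v0 = v0'"
    proof -
      \<comment> \<open>Up to this time neither velocity carries the particle past the fixed wall,
        so equal distances mean equal velocities.\<close>
      define s where "s = t0 + l t0 / (\<bar>v0\<bar> + \<bar>v0'\<bar> + 1)"
      have s: "s > t0" "(s - t0) * (\<bar>v0\<bar> + \<bar>v0'\<bar> + 1) = l t0"
        using wall_dist_pos[of t0] by (auto simp: s_def add_nonneg_pos)
      have small: "w * (s - t0) \<le> l t0" if "\<bar>w\<bar> \<le> \<bar>v0\<bar> + \<bar>v0'\<bar> + 1" for w
      proof -
        have "w * (s - t0) \<le> (\<bar>v0\<bar> + \<bar>v0'\<bar> + 1) * (s - t0)" using s that by (intro mult_right_mono) auto
        then show ?thesis using s(2) by (simp add: mult.commute)
      qed
      have "v0 * (s - t0) = v0' * (s - t0)"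
        using same[of s] small[of v0] small[of v0'] by simp
      then show ?thesis using s(1) by simp
    qed
    then show "z = z'" using t z by simp
  qed
qed

text \<open>
  Rational multiples of \<open>T\<close> suffice: an impact that is not at a corner is transversal, so that the
  extrapolated path leaves the region inside the wall for a short time interval.
\<close>

lemma next_time_less_iff:
  assumes z: "(t0, v0) \<in> X"
  shows "hit (t0, v0) < c \<longleftrightarrow> (\<exists>r\<in>\<rat>. t0 < r * T \<and> r * T < c \<and> l (r * T) \<le> pdist t0 v0 (r * T))"
proof
  assume "\<exists>r\<in>\<rat>. t0 < r * T \<and> r * T < c \<and> l (r * T) \<le> pdist t0 v0 (r * T)"
  then show "hit (t0, v0) < c" using next_time_le[OF z] by fastforce
next
  let ?h = "hit (t0, v0)" and ?u = "impact_velocity (t0, v0)"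
  assume c: "?h < c"
  show "\<exists>r\<in>\<rat>. t0 < r * T \<and> r * T < c \<and> l (r * T) \<le> pdist t0 v0 (r * T)"
  proof (cases "\<exists>n::int. ?h = real_of_int n * T")
    case True
    then obtain n :: int where "?h = real_of_int n * T" by blast
    then show ?thesis
      using c next_time_gt[OF z] next_time_dist[OF z] by (intro bexI[of _ "of_int n"]) auto
  next
    case False
    then obtain d where d: "d > 0" "\<And>s. ?h < s \<Longrightarrow> s < ?h + d \<Longrightarrow> l s = l ?h + vel ?h * (s - ?h)"
      using wall_dist_right_slope[of ?h] by metis
    have "?h / T < min c (?h + d) / T" using c d T_pos by (intro divide_strict_right_mono) auto
    then obtain r where r: "r \<in> \<rat>" "?h / T < r" "r < min c (?h + d) / T"
      using Rats_dense_in_real by blast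
    have rT: "?h < r * T" "r * T < c" "r * T < ?h + d"
      using r T_pos by (auto simp: field_simps min_def split: if_splits)
    have "l (r * T) = l ?h + vel ?h * (r * T - ?h)" using d rT by simp
    also have "\<dots> \<le> l ?h + ?u * (r * T - ?h)"
      using impact_velocity_gt[OF z] rT by (intro add_left_mono mult_right_mono) auto
    also have "\<dots> \<le> pdist t0 v0 (r * T)"
      unfolding flight_backwards[OF z] by (simp add: algebra_simps)
    finally show ?thesis using r(1) rT next_time_gt[OF z] by (intro bexI[of _ r]) auto
  qed
qed

end

section \<open>The invariant measure and recurrence\<close>

text \<open>Tonelli with the inner integral over \<open>t\<close>: for fixed \<open>v\<close> the
  map is affine with factor \<open>d v\<close>, and in \<open>v\<close> it is a translation,
  possibly with a reflection. The collision map has this form on countably many pieces.\<close>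

lemma shear_image_measure:
  fixes c d :: "real \<Rightarrow> real" and G :: "(real \<times> real) set" and w w' :: "real \<times> real \<Rightarrow> ennreal"
  assumes [measurable]: "c \<in> borel_measurable borel" "d \<in> borel_measurable borel" "G \<in> sets borel"
      "w \<in> borel_measurable borel" "w' \<in> borel_measurable borel"
    and \<sigma>: "\<sigma> = 1 \<or> \<sigma> = -1"
    and d: "\<And>t v. (t, v) \<in> G \<Longrightarrow> d v \<noteq> 0"
    and w: "\<And>t v. (t, v) \<in> G \<Longrightarrow> w (t, v) = ennreal \<bar>d v\<bar> * w' (c v + d v * t, \<sigma> * v + e)"
  defines "\<Phi> \<equiv> \<lambda>(t, v). (c v + d v * t, \<sigma> * v + e)"
  shows "\<Phi> ` G \<in> sets borel"
    and "(\<integral>\<^sup>+z. w' z * indicator (\<Phi> ` G) z \<partial>lborel) = (\<integral>\<^sup>+z. w z * indicator G z \<partial>lborel)"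
proof -
  have \<sigma>\<sigma>: "\<sigma> * (\<sigma> * x) = x" for x using \<sigma> by auto
  \<comment> \<open>The inverse where \<open>d v \<noteq> 0\<close>. Division by zero yields 0, so
    the lines with \<open>d v = 0\<close> have to be cut out of the preimage explicitly.\<close>
  define \<Psi> where "\<Psi> = (\<lambda>p. let v = \<sigma> * (snd p - e) in ((fst p - c v) / d v, v))"
  have image: "\<Phi> ` G = \<Psi> -` G \<inter> {p. d (\<sigma> * (snd p - e)) \<noteq> 0}"
  proof (intro set_eqI iffI)
    fix p assume "p \<in> \<Phi> ` G"
    then obtain t v where tv: "(t, v) \<in> G" "p = (c v + d v * t, \<sigma> * v + e)" by (auto simp: \<Phi>_def)
    then show "p \<in> \<Psi> -` G \<inter> {p. d (\<sigma> * (snd p - e)) \<noteq> 0}" using d[OF tv(1)] by (simp add: \<Psi>_def \<sigma>\<sigma>)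
  next
    fix p assume p: "p \<in> \<Psi> -` G \<inter> {p. d (\<sigma> * (snd p - e)) \<noteq> 0}"
    then have "p = \<Phi> (\<Psi> p)" by (cases p) (simp add: \<Phi>_def \<Psi>_def Let_def \<sigma>\<sigma>)
    then show "p \<in> \<Phi> ` G" using p by blast
  qed
  have [measurable]: "\<Psi> \<in> borel \<rightarrow>\<^sub>M borel"
    unfolding \<Psi>_def Let_def borel_prod[symmetric] by measurable
  show [measurable]: "\<Phi> ` G \<in> sets borel"
  proof -
    have "\<Psi> -` G \<in> sets borel" using measurable_sets[of \<Psi> borel borel G] by simp
    moreover have "{p::real \<times> real. d (\<sigma> * (snd p - e)) \<noteq> 0} \<in> sets borel"
    proof -
      have "{p \<in> space (borel \<Otimes>\<^sub>M borel :: (real \<times> real) measure). d (\<sigma> * (snd p - e)) \<noteq> 0} \<in> sets (borel \<Otimes>\<^sub>M borel)"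
        by measurable
      then show ?thesis unfolding borel_prod by simp
    qed
    ultimately show ?thesis unfolding image by (rule sets.Int)
  qed
  have mem: "\<Phi> (t, v) \<in> \<Phi> ` G \<longleftrightarrow> (t, v) \<in> G" if "d v \<noteq> 0" for t v
  proof
    assume "\<Phi> (t, v) \<in> \<Phi> ` G"
    then obtain t' v' where "(t', v') \<in> G" "\<Phi> (t', v') = \<Phi> (t, v)" by (metis imageE prod.collapse)
    then show "(t, v) \<in> G" using \<sigma> that by (auto simp: \<Phi>_def)
  qed auto
  have [measurable]: "(\<lambda>z. w' z * indicator (\<Phi> ` G) z) \<in> borel_measurable (borel \<Otimes>\<^sub>M borel)"
    "(\<lambda>z. w z * indicator G z) \<in> borel_measurable (borel \<Otimes>\<^sub>M borel)"
    unfolding borel_prod by measurable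
  define h where "h = (\<lambda>v'. \<integral>\<^sup>+t. w' (t, v') * indicator (\<Phi> ` G) (t, v') \<partial>lborel)"
  have h_meas: "h \<in> borel_measurable borel"
    unfolding h_def
  proof -
    have "(\<lambda>v'. \<integral>\<^sup>+t. (\<lambda>z. w' z * indicator (\<Phi> ` G) z) (t, v') \<partial>lborel) \<in> borel_measurable borel"
      by measurable
    then show "(\<lambda>v'. \<integral>\<^sup>+t. w' (t, v') * indicator (\<Phi> ` G) (t, v') \<partial>lborel) \<in> borel_measurable borel" by simp
  qed
  have inner: "h (e + \<sigma> * v) = (\<integral>\<^sup>+t. w (t, v) * indicator G (t, v) \<partial>lborel)" for v
  proof (cases "d v = 0")
    case True
    then have "(t, v) \<notin> G" "(t, e + \<sigma> * v) \<notin> \<Phi> ` G" for t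
      using d by (auto simp: image \<sigma>\<sigma>)
    then show ?thesis by (simp add: h_def)
  next
    case False
    have "h (e + \<sigma> * v) = ennreal \<bar>d v\<bar> *
        (\<integral>\<^sup>+t. w' (c v + d v * t, e + \<sigma> * v) * indicator (\<Phi> ` G) (c v + d v * t, e + \<sigma> * v) \<partial>lborel)"
      unfolding h_def
    proof (rule nn_integral_real_affine[OF _ False])
      have "(\<lambda>t. (\<lambda>z. w' z * indicator (\<Phi> ` G) z) (t, e + \<sigma> * v)) \<in> borel_measurable borel" by measurable
      then show "(\<lambda>t. w' (t, e + \<sigma> * v) * indicator (\<Phi> ` G) (t, e + \<sigma> * v)) \<in> borel_measurable borel" by simp
    qed
    also have "\<dots> = (\<integral>\<^sup>+t. ennreal \<bar>d v\<bar> * (w' (c v + d v * t, e + \<sigma> * v) * indicator (\<Phi> ` G) (c v + d v * t, e + \<sigma> * v)) \<partial>lborel)"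
    proof (rule nn_integral_cmult[symmetric])
      have "(\<lambda>t. (\<lambda>z. w' z * indicator (\<Phi> ` G) z) (c v + d v * t, e + \<sigma> * v)) \<in> borel_measurable borel" by measurable
      then show "(\<lambda>t. w' (c v + d v * t, e + \<sigma> * v) * indicator (\<Phi> ` G) (c v + d v * t, e + \<sigma> * v)) \<in> borel_measurable lborel" by simp
    qed
    also have "\<dots> = (\<integral>\<^sup>+t. w (t, v) * indicator G (t, v) \<partial>lborel)"
    proof (rule nn_integral_cong)
      fix t
      show "ennreal \<bar>d v\<bar> * (w' (c v + d v * t, e + \<sigma> * v) * indicator (\<Phi> ` G) (c v + d v * t, e + \<sigma> * v))
          = w (t, v) * indicator G (t, v)"
        using mem[OF False, of t] w[of t v] by (auto simp: \<Phi>_def indicator_def mult.assoc add.commute)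
    qed
    finally show ?thesis .
  qed
  have "(\<integral>\<^sup>+z. w' z * indicator (\<Phi> ` G) z \<partial>lborel) = (\<integral>\<^sup>+v'. h v' \<partial>lborel)"
    unfolding h_def lborel_prod[symmetric]
    by (rule lborel_pair.nn_integral_snd[symmetric]) measurable
  also have "\<dots> = ennreal \<bar>\<sigma>\<bar> * (\<integral>\<^sup>+v. h (e + \<sigma> * v) \<partial>lborel)"
    by (rule nn_integral_real_affine[OF h_meas]) (use \<sigma> in auto)
  also have "\<dots> = (\<integral>\<^sup>+v. h (e + \<sigma> * v) \<partial>lborel)" using \<sigma> by auto
  also have "\<dots> = (\<integral>\<^sup>+z. w z * indicator G z \<partial>lborel)"
    unfolding inner lborel_prod[symmetric]
    by (rule lborel_pair.nn_integral_snd) measurable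
  finally show "(\<integral>\<^sup>+z. w' z * indicator (\<Phi> ` G) z \<partial>lborel) = (\<integral>\<^sup>+z. w z * indicator G z \<partial>lborel)" .
qed

section \<open>Poincare recurrence for an injective map of a possibly infinite measure space\<close>

text \<open>Invariance is stated for forward images: an injective map may miss part of the space,
  and then preimages can lose measure. For null sets the resulting inequality is enough.\<close>

locale injective_mpt =
  fixes M :: "'a measure" and f :: "'a \<Rightarrow> 'a"
  assumes f_measurable [measurable]: "f \<in> M \<rightarrow>\<^sub>M M"
    and f_inj: "inj_on f (space M)"
    and f_image: "\<And>E. E \<in> sets M \<Longrightarrow> f ` E \<in> sets M"
    and f_emeasure: "\<And>E. E \<in> sets M \<Longrightarrow> emeasure M (f ` E) = emeasure M E"
begin

lemma funpow_space: "z \<in> space M \<Longrightarrow> (f ^^ n) z \<in> space M"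
  by (induction n) (auto intro: measurable_space[OF f_measurable])

lemma funpow_measurable [measurable]: "(f ^^ n) \<in> M \<rightarrow>\<^sub>M M"
  by (induction n) (auto intro: measurable_comp f_measurable)

lemma funpow_inj: "inj_on (f ^^ n) (space M)"
proof (induction n)
  case (Suc n)
  show ?case
  proof (rule inj_onI)
    fix x y assume xy: "x \<in> space M" "y \<in> space M" "(f ^^ Suc n) x = (f ^^ Suc n) y"
    then have "(f ^^ n) x = (f ^^ n) y"
      using f_inj funpow_space by (auto dest: inj_onD)
    then show "x = y" using Suc xy by (auto dest: inj_onD)
  qed
qed simp

lemma funpow_image:
  assumes "E \<in> sets M"
  shows "(f ^^ n) ` E \<in> sets M \<and> emeasure M ((f ^^ n) ` E) = emeasure M E"
proof (induction n)
  case (Suc n)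
  have "(f ^^ Suc n) ` E = f ` ((f ^^ n) ` E)" by (auto simp: image_image)
  then show ?case using Suc f_image f_emeasure by simp
qed (use assms in simp)

lemma AE_funpow_not_in_null:
  assumes "N \<in> sets M" "emeasure M N = 0"
  shows "AE z in M. \<forall>n. (f ^^ n) z \<notin> N"
proof (subst AE_all_countable, intro allI)
  fix n
  let ?P = "(f ^^ n) -` N \<inter> space M"
  have P: "?P \<in> sets M" using assms(1) by (rule measurable_sets[OF funpow_measurable])
  have "emeasure M ?P = emeasure M ((f ^^ n) ` ?P)" using funpow_image[OF P] by simp
  also have "\<dots> \<le> emeasure M N" using assms(1) by (intro emeasure_mono) auto
  finally have "?P \<in> null_sets M" using assms(2) P by auto
  then show "AE z in M. (f ^^ n) z \<notin> N" by (rule AE_I') auto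
qed

text \<open>Let \<open>H n\<close> be the points of \<open>W\<close> that are in \<open>K\<close> at
  time \<open>n\<close>. Their images under \<open>f ^^ n\<close> are disjoint subsets of
  \<open>K\<close> of the same measures, so these measures are summable and Borel-Cantelli leaves
  almost every point in only finitely many \<open>H n\<close>.\<close>

lemma AE_wandering_escapes:
  assumes W: "W \<in> sets M" and wand: "\<And>z n. z \<in> W \<Longrightarrow> 0 < n \<Longrightarrow> (f ^^ n) z \<notin> W"
    and K: "K \<in> sets M" "emeasure M K < \<infinity>"
  shows "AE z in M. z \<in> W \<longrightarrow> (\<forall>\<^sub>F n in sequentially. (f ^^ n) z \<notin> K)"
proof -
  define H where "H n = W \<inter> ((f ^^ n) -` K \<inter> space M)" for n
  have H: "H n \<in> sets M" for n
    unfolding H_def using W measurable_sets[OF funpow_measurable K(1)] by blast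
  have W_space: "W \<subseteq> space M" using W by (rule sets.sets_into_space)
  have disjoint: "(f ^^ m) x \<noteq> (f ^^ n) y" if "m < n" "x \<in> W" "y \<in> W" for m n x y
  proof
    assume eq: "(f ^^ m) x = (f ^^ n) y"
    have "(f ^^ n) y = (f ^^ m) ((f ^^ (n - m)) y)"
      using that(1) by (metis add_diff_inverse_nat comp_apply funpow_add less_imp_not_less)
    then have "x = (f ^^ (n - m)) y"
      using eq that W_space funpow_space funpow_inj[of m] by (metis inj_onD subsetD)
    then show False using wand[OF that(3), of "n - m"] that by simp
  qed
  have "disjoint_family (\<lambda>n. (f ^^ n) ` H n)"
    unfolding disjoint_family_on_def
  proof (intro ballI impI)
    fix m n :: nat assume "m \<noteq> n"
    then consider "m < n" | "n < m" by linarith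
    then show "(f ^^ m) ` H m \<inter> (f ^^ n) ` H n = {}"
      by cases (use disjoint in \<open>fastforce simp: H_def\<close>)+
  qed
  then have "(\<Sum>n. emeasure M ((f ^^ n) ` H n)) = emeasure M (\<Union>n. (f ^^ n) ` H n)"
    using funpow_image[OF H] by (intro suminf_emeasure) auto
  also have "\<dots> \<le> emeasure M K" using K(1) by (intro emeasure_mono) (auto simp: H_def)
  finally have sum: "(\<Sum>n. emeasure M (H n)) \<le> emeasure M K" using funpow_image[OF H] by simp
  have fin: "emeasure M (H n) < \<infinity>" for n
  proof -
    have "emeasure M (H n) = emeasure M ((f ^^ n) ` H n)" using funpow_image[OF H] by simp
    also have "\<dots> \<le> emeasure M K" using K(1) by (intro emeasure_mono) (auto simp: H_def)
    finally show ?thesis using K(2) by simp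
  qed
  have "summable (\<lambda>n. measure M (H n))"
  proof (rule summable_suminf_not_top)
    have "(\<Sum>n. ennreal (measure M (H n))) = (\<Sum>n. emeasure M (H n))"
      using fin by (intro suminf_cong) (simp add: emeasure_eq_ennreal_measure less_top)
    then show "(\<Sum>n. ennreal (measure M (H n))) \<noteq> top" using sum K(2) by (auto simp: top_unique)
  qed simp
  from borel_cantelli_AE1[OF H fin this]
  show ?thesis
  proof (rule AE_mp, intro AE_I2 impI)
    fix z assume z: "z \<in> space M" "\<forall>\<^sub>F n in sequentially. z \<in> space M - H n" "z \<in> W"
    then show "\<forall>\<^sub>F n in sequentially. (f ^^ n) z \<notin> K"
      by (elim eventually_mono) (auto simp: H_def)
  qed
qed

text \<open>The points of \<open>E\<close> that never come back form a wandering set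
  \<open>W\<close>; almost all of them would leave every \<open>K i\<close> for good, against
  \<open>visits\<close>, so \<open>W\<close> is null. An orbit that never enters \<open>W\<close>
  has no last visit to \<open>E\<close>.\<close>

lemma AE_returns_infinitely_often:
  fixes K :: "nat \<Rightarrow> 'a set"
  assumes K: "\<And>i. K i \<in> sets M" "\<And>i. emeasure M (K i) < \<infinity>"
    and visits: "AE z in M. \<exists>i. \<exists>\<^sub>F n in sequentially. (f ^^ n) z \<in> K i"
    and E: "E \<in> sets M"
  shows "AE z in M. z \<in> E \<longrightarrow> (\<exists>\<^sub>F n in sequentially. (f ^^ n) z \<in> E)"
proof -
  define W where "W = E - (\<Union>n. (f ^^ Suc n) -` E \<inter> space M)"
  have W: "W \<in> sets M"
  proof -
    have "range (\<lambda>n. (f ^^ Suc n) -` E \<inter> space M) \<subseteq> sets M"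
      using measurable_sets[OF funpow_measurable E] by blast
    then show ?thesis unfolding W_def by (intro sets.Diff E sets.countable_UN)
  qed
  have W_out: "(f ^^ n) z \<notin> E" if z: "z \<in> W" and n: "0 < n" for z n
  proof -
    obtain m where "n = Suc m" using n by (cases n) auto
    then show ?thesis using z sets.sets_into_space[OF W] by (auto simp: W_def)
  qed
  have WE: "W \<subseteq> E" by (auto simp: W_def)
  have "AE z in M. \<forall>i. z \<in> W \<longrightarrow> (\<forall>\<^sub>F n in sequentially. (f ^^ n) z \<notin> K i)"
    unfolding AE_all_countable
    using AE_wandering_escapes[OF W _ K] W_out WE by blast
  then have "AE z in M. z \<notin> W"
    using visits by eventually_elim (auto simp: frequently_def)
  then have "emeasure M W = 0"
    using W sets.sets_into_space[OF W] by (subst (asm) AE_iff_measurable[of W]) auto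
  from AE_funpow_not_in_null[OF W this]
  show ?thesis
  proof (rule AE_mp, intro AE_I2 impI)
    fix z assume z: "z \<in> space M" "\<forall>n. (f ^^ n) z \<notin> W" "z \<in> E"
    show "\<exists>\<^sub>F n in sequentially. (f ^^ n) z \<in> E"
    proof (rule ccontr)
      assume "\<not> (\<exists>\<^sub>F n in sequentially. (f ^^ n) z \<in> E)"
      then obtain N where N: "\<And>n. n \<ge> N \<Longrightarrow> (f ^^ n) z \<notin> E"
        by (auto simp: frequently_def eventually_sequentially)
      define S where "S = {n. (f ^^ n) z \<in> E}"
      have "S \<subseteq> {..<N}" using N by (force simp: S_def not_le[symmetric])
      then have S: "finite S" by (rule finite_subset) simp
      have "0 \<in> S" using z(3) by (simp add: S_def)
      then have max: "Max S \<in> S" using S by (intro Max_in) auto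
      have "(f ^^ Max S) z \<in> W"
      proof -
        have "(f ^^ Suc n) ((f ^^ Max S) z) \<notin> E" for n
        proof
          assume "(f ^^ Suc n) ((f ^^ Max S) z) \<in> E"
          then have "Suc n + Max S \<in> S" by (simp add: S_def funpow_add)
          then show False using Max_ge[OF S] by fastforce
        qed
        then show ?thesis using max by (auto simp: W_def S_def)
      qed
      then show False using z(2) by blast
    qed
  qed
qed

end

section \<open>The flux measure of the collision map\<close>

context accelerator
begin

text \<open>The pieces partition the time axis. Both corners belong to the inward piece, in
  agreement with the values of \<open>vel\<close> there.\<close>

definition wall_piece :: "bool \<Rightarrow> int \<Rightarrow> real set" where
  "wall_piece c n = (if c then {(2 * real_of_int n + 1) * T<..<2 * (real_of_int n + 1) * T}
     else {2 * real_of_int n * T..(2 * real_of_int n + 1) * T})"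

definition slope :: "bool \<Rightarrow> real" where
  "slope c = (if c then k else - k)"

definition offset :: "bool \<Rightarrow> int \<Rightarrow> real" where
  "offset c n = (if c then A - k * ((2 * real_of_int n + 1) * T) else A + k * ((2 * real_of_int n + 1) * T))"

lemma wall_piece_cell: "t \<in> wall_piece c n \<Longrightarrow> 2 * real_of_int n * T \<le> t \<and> t < 2 * (real_of_int n + 1) * T"
  using T_pos by (auto simp: wall_piece_def algebra_simps split: if_splits)

lemma wall_piece_cover: "\<exists>c n. t \<in> wall_piece c n"
proof -
  obtain n :: int where "2 * real_of_int n * T \<le> t" "t < 2 * (real_of_int n + 1) * T" using period_cell by blast
  then have "t \<in> wall_piece (t > (2 * real_of_int n + 1) * T) n" by (auto simp: wall_piece_def)
  then show ?thesis by blast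
qed

lemma wall_piece_disjoint:
  assumes "t \<in> wall_piece c n" "t \<in> wall_piece c' n'"
  shows "c = c' \<and> n = n'"
proof -
  have "2 * real_of_int n * T < 2 * (real_of_int n' + 1) * T" "2 * real_of_int n' * T < 2 * (real_of_int n + 1) * T"
    using assms[THEN wall_piece_cell] by auto
  then have "n = n'" using T_pos by simp
  then show ?thesis using assms by (auto simp: wall_piece_def split: if_splits)
qed

lemma wall_piece_vel: "t \<in> wall_piece c n \<Longrightarrow> vel t = slope c"
  using wall_piece_cell[of t c n] wall_vel_cell[of n t] by (auto simp: wall_piece_def slope_def split: if_splits)

lemma wall_piece_dist: "t \<in> wall_piece c n \<Longrightarrow> l t = offset c n + slope c * t"
  using wall_piece_cell[of t c n] wall_dist_cell[of n t]
  by (auto simp: wall_piece_def slope_def offset_def algebra_simps split: if_splits)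

lemma borel_measurable_wall_dist [measurable]: "l \<in> borel_measurable borel"
  by (intro borel_measurable_continuous_onI continuous_wall_dist)

lemma borel_measurable_wall_vel [measurable]: "vel \<in> borel_measurable borel"
  unfolding wall_vel_def rmod_def by measurable

lemma phase_cylinder_sets [measurable]: "X \<in> sets borel"
proof -
  have "X = {z \<in> space (borel \<Otimes>\<^sub>M borel :: (real \<times> real) measure).
      0 \<le> fst z \<and> fst z < 2 * T \<and> - vel (fst z) < snd z}"
    by (auto simp: phase_cylinder_def space_pair_measure)
  also have "\<dots> \<in> sets (borel \<Otimes>\<^sub>M borel)" by measurable
  finally show ?thesis unfolding borel_prod .
qed

text \<open>Velocity relative to the moving wall. It is positive on the phase cylinder, so the
  weighted measure has the null sets of Lebesgue measure there.\<close>

definition flux_density :: "real \<times> real \<Rightarrow> ennreal" where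
  "flux_density z = ennreal (snd z + vel (fst z))"

definition flux :: "(real \<times> real) measure" where
  "flux = restrict_space (density lborel flux_density) X"

lemma borel_measurable_flux_density [measurable]: "flux_density \<in> borel_measurable borel"
  unfolding flux_density_def borel_prod[symmetric] by measurable

lemma space_flux [simp]: "space flux = X"
  by (simp add: flux_def space_restrict_space)

lemma sets_flux: "E \<in> sets flux \<longleftrightarrow> E \<in> sets borel \<and> E \<subseteq> X"
  unfolding flux_def by (subst sets_restrict_space_iff) (auto simp: phase_cylinder_sets)

lemma emeasure_flux:
  assumes "E \<in> sets flux"
  shows "emeasure flux E = (\<integral>\<^sup>+z. flux_density z * indicator E z \<partial>lborel)"
  using assms unfolding sets_flux unfolding flux_def
  by (subst emeasure_restrict_space) (auto simp: emeasure_density phase_cylinder_sets)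

lemma AE_flux_iff: "(AE z in flux. P z) \<longleftrightarrow> (AE z in lborel. z \<in> X \<longrightarrow> P z)"
proof -
  have "(AE z in flux. P z) \<longleftrightarrow> (AE z in lborel. 0 < flux_density z \<longrightarrow> z \<in> X \<longrightarrow> P z)"
    unfolding flux_def by (subst AE_restrict_space_iff) (auto simp: phase_cylinder_sets AE_density)
  also have "\<dots> \<longleftrightarrow> (AE z in lborel. z \<in> X \<longrightarrow> P z)"
    by (rule AE_cong) (auto simp: flux_density_def phase_cylinder_def)
  finally show ?thesis .
qed

lemma measurable_restrict_borel:
  "f \<in> borel_measurable (restrict_space borel X) \<Longrightarrow> f \<in> borel_measurable flux"
proof -
  have "sets flux = sets (restrict_space borel X)" by (simp add: flux_def sets_restrict_space)
  then show "f \<in> borel_measurable (restrict_space borel X) \<Longrightarrow> f \<in> borel_measurable flux"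
    by (subst measurable_cong_sets[OF _ refl]) auto
qed

lemma borel_measurable_fst_snd_flux [measurable]:
  "fst \<in> borel_measurable flux" "snd \<in> borel_measurable flux"
  by (auto intro!: measurable_restrict_borel measurable_restrict_space1 borel_measurable_continuous_onI continuous_intros)

lemma borel_measurable_next_time [measurable]: "hit \<in> borel_measurable flux"
proof (rule borel_measurable_iff_less[THEN iffD2], intro allI)
  fix c
  have "{z \<in> space flux. hit z < c} = (\<Union>r\<in>{r \<in> \<rat>. r * T < c}.
      {z \<in> space flux. fst z < r * T \<and> l (r * T) \<le> \<bar>l (fst z) - snd z * (r * T - fst z)\<bar>})"
    using next_time_less_iff by fastforce
  also have "\<dots> \<in> sets flux"
  proof (rule sets.countable_UN'')
    show "countable {r \<in> \<rat>. r * T < c}" by (rule countable_subset[OF _ countable_rat]) auto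
    fix r :: real
    show "{z \<in> space flux. fst z < r * T \<and> l (r * T) \<le> \<bar>l (fst z) - snd z * (r * T - fst z)\<bar>} \<in> sets flux"
      by measurable
  qed
  finally show "{z \<in> space flux. hit z < c} \<in> sets flux" .
qed

lemma borel_measurable_impact_velocity [measurable]: "impact_velocity \<in> borel_measurable flux"
proof -
  have "impact_velocity = (\<lambda>z. if l (fst z) < snd z * (hit z - fst z) then snd z else - snd z)"
    by (auto simp: impact_velocity_def fun_eq_iff)
  then show ?thesis by simp
qed

lemma measurable_collision_map: "F \<in> flux \<rightarrow>\<^sub>M flux"
proof -
  have "(\<lambda>z. (hit z rmod (2 * T), impact_velocity z - 2 * vel (hit z))) \<in> flux \<rightarrow>\<^sub>M borel \<Otimes>\<^sub>M borel"
    unfolding rmod_def by measurable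
  moreover have "F = (\<lambda>z. (hit z rmod (2 * T), impact_velocity z - 2 * vel (hit z)))"
    by (simp add: collision_map_eq fun_eq_iff)
  ultimately have "F \<in> flux \<rightarrow>\<^sub>M borel" by (simp add: borel_prod)
  then have "F \<in> flux \<rightarrow>\<^sub>M density lborel flux_density" by (simp add: measurable_def)
  then have "F \<in> flux \<rightarrow>\<^sub>M restrict_space (density lborel flux_density) X"
    by (rule measurable_restrict_space2[rotated]) (use collision_map_in_phase_cylinder in auto)
  then show ?thesis unfolding flux_def[symmetric] .
qed

text \<open>Indexed by the slope at departure, the slope and period of the impact, and whether the
  fixed wall is hit in between. On each piece the time of impact is affine in \<open>t\<close> for
  fixed \<open>v\<close>.\<close>

definition flight_piece :: "bool \<times> bool \<times> int \<times> bool \<Rightarrow> (real \<times> real) set" where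
  "flight_piece = (\<lambda>(b, c, n, s). {z \<in> X. fst z \<in> wall_piece b 0 \<and> hit z \<in> wall_piece c n \<and>
     (l (fst z) < snd z * (hit z - fst z) \<longleftrightarrow> s)})"

lemma flight_piece_sets: "flight_piece i \<in> sets flux"
proof -
  obtain b c n s where i: "i = (b, c, n, s)" by (cases i)
  have [measurable]: "wall_piece b n \<in> sets borel" for b n by (simp add: wall_piece_def)
  have "{z \<in> space flux. fst z \<in> wall_piece b 0 \<and> hit z \<in> wall_piece c n \<and>
     (l (fst z) < snd z * (hit z - fst z) \<longleftrightarrow> s)} \<in> sets flux" by measurable
  then show ?thesis by (simp add: i flight_piece_def)
qed

lemma flight_piece_disjoint: "disjoint_family flight_piece"
  unfolding disjoint_family_on_def flight_piece_def using wall_piece_disjoint by fastforce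

lemma flight_piece_cover: "X \<subseteq> (\<Union>i. flight_piece i)"
proof
  fix z assume z: "z \<in> X"
  obtain c n where c: "hit z \<in> wall_piece c n" using wall_piece_cover by blast
  have "fst z \<in> wall_piece (fst z > T) 0"
    using z by (auto simp: phase_cylinder_def wall_piece_def)
  then have "z \<in> flight_piece (fst z > T, c, n, l (fst z) < snd z * (hit z - fst z))"
    using z c by (simp add: flight_piece_def)
  then show "z \<in> (\<Union>i. flight_piece i)" by blast
qed

text \<open>On a piece the impact equation is linear in the two collision times. The factor
  \<open>da v\<close> has as its modulus the relative speed at departure divided by the relative
  speed at impact; elastic reflection keeps the latter, which makes it the flux density of the
  image.\<close>

lemma collision_map_image_piece:
  assumes E: "E \<in> sets flux" and sub: "E \<subseteq> flight_piece i"
  shows "F ` E \<in> sets flux \<and> emeasure flux (F ` E) = emeasure flux E"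
proof -
  obtain b c n s where i: "i = (b, c, n, s)" by (cases i)
  define \<sigma> :: real where "\<sigma> = (if s then 1 else -1)"
  have \<sigma>: "\<sigma> = 1 \<or> \<sigma> = -1" by (simp add: \<sigma>_def)
  define ca where "ca = (\<lambda>v. (offset c n + \<sigma> * offset b 0) / (\<sigma> * v - slope c) - 2 * real_of_int n * T)"
  define da where "da = (\<lambda>v. \<sigma> * (v + slope b) / (\<sigma> * v - slope c))"
  have EX: "E \<subseteq> X" "E \<in> sets borel" using E by (auto simp: sets_flux)
  have facts: "0 < v + slope b" "0 < \<sigma> * v - slope c" "F (t, v) = (ca v + da v * t, \<sigma> * v + - (2 * slope c))"
    "flux_density (t, v) = ennreal (v + slope b)" "flux_density (F (t, v)) = ennreal (\<sigma> * v - slope c)"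
    if tv: "(t, v) \<in> E" for t v
  proof -
    have X: "(t, v) \<in> X" using tv EX by blast
    have p: "t \<in> wall_piece b 0" "hit (t, v) \<in> wall_piece c n" "l t < v * (hit (t, v) - t) \<longleftrightarrow> s"
      using tv sub by (auto simp: i flight_piece_def)
    have u: "impact_velocity (t, v) = \<sigma> * v" using p(3) by (simp add: impact_velocity_def \<sigma>_def)
    have vt: "vel t = slope b" and vh: "vel (hit (t, v)) = slope c"
      using p wall_piece_vel by auto
    show pos0: "0 < v + slope b" using X vt by (simp add: phase_cylinder_iff)
    show pos1: "0 < \<sigma> * v - slope c" using impact_velocity_gt[OF X] u vh by simp
    \<comment> \<open>Both kinds of flight in one equation: \<open>\<sigma> = 1\<close> with a
      reflection at the fixed wall, \<open>\<sigma> = -1\<close> without.\<close>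
    have "\<sigma> * (v * (hit (t, v) - t) - l t) = l (hit (t, v))"
      using next_time_dist[OF X] p(3) wall_dist_pos[of "hit (t, v)"] by (auto simp: \<sigma>_def)
    then have "(\<sigma> * v - slope c) * hit (t, v) = offset c n + \<sigma> * offset b 0 + \<sigma> * (v + slope b) * t"
      using wall_piece_dist[OF p(1)] wall_piece_dist[OF p(2)] by (simp add: algebra_simps)
    then have "hit (t, v) = (offset c n + \<sigma> * offset b 0 + \<sigma> * (v + slope b) * t) / (\<sigma> * v - slope c)"
      using pos1 by (simp add: nonzero_eq_divide_eq mult.commute)
    then have "hit (t, v) - 2 * real_of_int n * T = ca v + da v * t"
      by (simp add: ca_def da_def add_divide_distrib)
    moreover have "hit (t, v) rmod (2 * T) = hit (t, v) - 2 * real_of_int n * T"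
      using wall_piece_cell[OF p(2)] by (intro rmod_period) auto
    ultimately show Fz: "F (t, v) = (ca v + da v * t, \<sigma> * v + - (2 * slope c))"
      by (simp add: collision_map_eq u vh)
    show "flux_density (t, v) = ennreal (v + slope b)" by (simp add: flux_density_def vt)
    show "flux_density (F (t, v)) = ennreal (\<sigma> * v - slope c)"
      by (simp add: flux_density_def collision_map_eq u vh)
  qed
  have img: "F ` E = (\<lambda>(t, v). (ca v + da v * t, \<sigma> * v + - (2 * slope c))) ` E"
    using facts(3) by (intro image_cong) auto
  have meas: "ca \<in> borel_measurable borel" "da \<in> borel_measurable borel"
    unfolding ca_def da_def by measurable
  note shear = shear_image_measure[OF meas EX(2) borel_measurable_flux_density borel_measurable_flux_density \<sigma>,
      where e = "- (2 * slope c)", folded img]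
  have d: "da v \<noteq> 0" if "(t, v) \<in> E" for t v
    using facts(1,2)[OF that] \<sigma> by (auto simp: da_def)
  have w: "flux_density (t, v) = ennreal \<bar>da v\<bar> * flux_density (ca v + da v * t, \<sigma> * v + - (2 * slope c))"
    if tv: "(t, v) \<in> E" for t v
  proof -
    have "\<bar>da v\<bar> = (v + slope b) / (\<sigma> * v - slope c)"
      using facts(1,2)[OF tv] \<sigma> by (auto simp: da_def abs_mult)
    then have "v + slope b = \<bar>da v\<bar> * (\<sigma> * v - slope c)" using facts(2)[OF tv] by simp
    moreover have "flux_density (ca v + da v * t, \<sigma> * v + - (2 * slope c)) = ennreal (\<sigma> * v - slope c)"
      using facts(3,5)[OF tv] by simp
    ultimately show ?thesis using facts(2,4)[OF tv] by (simp add: ennreal_mult[symmetric])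
  qed
  have FE: "F ` E \<in> sets flux"
    using shear(1)[OF d w] EX collision_map_in_phase_cylinder by (auto simp: sets_flux)
  then show ?thesis using shear(2)[OF d w] E by (simp add: emeasure_flux)
qed

lemma collision_map_image:
  assumes E: "E \<in> sets flux"
  shows "F ` E \<in> sets flux \<and> emeasure flux (F ` E) = emeasure flux E"
proof -
  have EX: "E \<subseteq> X" using E by (simp add: sets_flux)
  have P: "E \<inter> flight_piece i \<in> sets flux" for i using E flight_piece_sets by auto
  have image: "F ` (E \<inter> flight_piece i) \<in> sets flux"
    "emeasure flux (F ` (E \<inter> flight_piece i)) = emeasure flux (E \<inter> flight_piece i)" for i
    using collision_map_image_piece[OF P] by blast+
  have E_eq: "E = (\<Union>i. E \<inter> flight_piece i)" using EX flight_piece_cover by blast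
  have FE_eq: "F ` E = (\<Union>i. F ` (E \<inter> flight_piece i))" by (subst E_eq) (rule image_UN)
  have d1: "disjoint_family (\<lambda>i. E \<inter> flight_piece i)"
    using flight_piece_disjoint unfolding disjoint_family_on_def by blast
  have d2: "disjoint_family (\<lambda>i. F ` (E \<inter> flight_piece i))"
    unfolding disjoint_family_on_def
  proof (intro ballI impI)
    fix i j :: "bool \<times> bool \<times> int \<times> bool" assume "i \<noteq> j"
    then have "(E \<inter> flight_piece i) \<inter> (E \<inter> flight_piece j) = {}"
      using d1 unfolding disjoint_family_on_def by blast
    then show "F ` (E \<inter> flight_piece i) \<inter> F ` (E \<inter> flight_piece j) = {}"
      using inj_on_image_Int[OF inj_on_collision_map, of "E \<inter> flight_piece i" "E \<inter> flight_piece j"] EX by blast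
  qed
  have "emeasure flux (F ` E) = (\<integral>\<^sup>+i. emeasure flux (F ` (E \<inter> flight_piece i)) \<partial>count_space UNIV)"
    unfolding FE_eq by (rule emeasure_UN_countable[OF image(1) countableI_type d2])
  also have "\<dots> = (\<integral>\<^sup>+i. emeasure flux (E \<inter> flight_piece i) \<partial>count_space UNIV)"
    unfolding image(2) ..
  also have "\<dots> = emeasure flux (\<Union>i. E \<inter> flight_piece i)"
    by (rule emeasure_UN_countable[OF P countableI_type d1, symmetric])
  finally have "emeasure flux (F ` E) = emeasure flux E" using E_eq by simp
  moreover have "F ` E \<in> sets flux"
    unfolding FE_eq by (rule sets.countable_UN''[OF countableI_type image(1)])
  ultimately show ?thesis by blast
qed

sublocale collision: injective_mpt flux F
  using measurable_collision_map inj_on_collision_map collision_map_image by unfold_locales auto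

definition slow :: "nat \<Rightarrow> (real \<times> real) set" where
  "slow i = {z \<in> X. \<bar>snd z\<bar> \<le> real i}"

lemma slow_sets: "slow i \<in> sets flux"
proof -
  have "{z \<in> space flux. \<bar>snd z\<bar> \<le> real i} \<in> sets flux" by measurable
  then show ?thesis by (simp add: slow_def)
qed

lemma emeasure_slow: "emeasure flux (slow i) < \<infinity>"
proof -
  let ?R = "cbox (0, - real i) (2 * T, real i)"
  have "emeasure flux (slow i) \<le> (\<integral>\<^sup>+z. ennreal (real i + k) * indicator ?R z \<partial>lborel)"
    unfolding emeasure_flux[OF slow_sets]
  proof (rule nn_integral_mono)
    fix z :: "real \<times> real"
    have "flux_density z \<le> ennreal (real i + k)" if "\<bar>snd z\<bar> \<le> real i"
      unfolding flux_density_def using that wall_vel_cases[of "fst z"] k_pos by (intro ennreal_leI) auto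
    moreover have "z \<in> slow i \<Longrightarrow> z \<in> ?R"
      by (cases z) (auto simp: slow_def phase_cylinder_def cbox_Pair_iff)
    ultimately show "flux_density z * indicator (slow i) z \<le> ennreal (real i + k) * indicator ?R z"
      by (auto simp: indicator_def slow_def)
  qed
  also have "\<dots> = ennreal (real i + k) * emeasure lborel ?R"
    by (rule nn_integral_cmult_indicator) simp
  also have "\<dots> < \<infinity>"
    using emeasure_lborel_cbox_finite[of "(0, - real i)" "(2 * T, real i)"]
    by (simp add: ennreal_mult_less_top)
  finally show ?thesis .
qed

text \<open>A non-escaping orbit has bounded energy infinitely often, hence visits some
  \<open>slow i\<close>, a set of finite measure, infinitely often. Recurrence is applied to the
  countably many momentum strips with rational endpoints, which fit around every level.\<close>

lemma AE_momentum_recurrent: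
  assumes noesc: "AE z in flux. z \<notin> escaping_set A B T"
  shows "AE z in flux. momentum_recurrent A B T z"
proof -
  define J where "J = momentum A B T"
  have [measurable]: "J \<in> borel_measurable flux"
  proof -
    have "J = (\<lambda>z. integral {0..T} (\<lambda>s. 1 / (l s)\<^sup>2) * (l (fst z) * snd z + l (fst z) * vel (fst z)))"
      by (auto simp: J_def momentum_def fun_eq_iff)
    then show ?thesis by simp
  qed
  have visits: "AE z in flux. \<exists>i. \<exists>\<^sub>F n in sequentially. (F ^^ n) z \<in> slow i"
    using noesc
  proof (rule AE_mp, intro AE_I2 impI)
    fix z assume z: "z \<in> space flux" "z \<notin> escaping_set A B T"
    then have "\<not> filterlim (\<lambda>n. energy ((F ^^ n) z)) at_top sequentially"
      by (simp add: escaping_set_def)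
    then obtain C where "\<exists>\<^sub>F n in sequentially. energy ((F ^^ n) z) < C"
      by (auto simp: filterlim_at_top frequently_def not_less)
    moreover obtain i where i: "max 1 (2 * C) < real i" using reals_Archimedean2 by blast
    have "(F ^^ n) z \<in> slow i" if "energy ((F ^^ n) z) < C" for n
    proof -
      have "(snd ((F ^^ n) z))\<^sup>2 < 2 * C" using that by (simp add: energy_def split: prod.splits)
      also have "2 * C \<le> real i * 1" using i by simp
      also have "\<dots> \<le> real i * real i" using i by (intro mult_left_mono) auto
      finally have "\<bar>snd ((F ^^ n) z)\<bar> \<le> \<bar>real i\<bar>"
        unfolding abs_le_square_iff by (simp add: power2_eq_square)
      then show ?thesis using collision.funpow_space[OF z(1), of n] by (simp add: slow_def)
    qed
    ultimately show "\<exists>i. \<exists>\<^sub>F n in sequentially. (F ^^ n) z \<in> slow i"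
      by (intro exI[of _ i]) (rule frequently_elim1)
  qed
  have ret: "AE z in flux. z \<in> {z \<in> space flux. real_of_rat a < J z \<and> J z < real_of_rat b} \<longrightarrow>
      (\<exists>\<^sub>F n in sequentially. (F ^^ n) z \<in> {z \<in> space flux. real_of_rat a < J z \<and> J z < real_of_rat b})" for a b
    by (rule collision.AE_returns_infinitely_often[OF slow_sets emeasure_slow visits]) measurable
  then have "AE z in flux. \<forall>a b. z \<in> {z \<in> space flux. real_of_rat a < J z \<and> J z < real_of_rat b} \<longrightarrow>
      (\<exists>\<^sub>F n in sequentially. (F ^^ n) z \<in> {z \<in> space flux. real_of_rat a < J z \<and> J z < real_of_rat b})"
    unfolding AE_all_countable by blast
  then show ?thesis
  proof (rule AE_mp, intro AE_I2 impI)
    fix z assume z: "z \<in> space flux" and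
      r: "\<forall>a b. z \<in> {z \<in> space flux. real_of_rat a < J z \<and> J z < real_of_rat b} \<longrightarrow>
      (\<exists>\<^sub>F n in sequentially. (F ^^ n) z \<in> {z \<in> space flux. real_of_rat a < J z \<and> J z < real_of_rat b})"
    show "momentum_recurrent A B T z"
      unfolding momentum_recurrent_def J_def[symmetric]
    proof (intro allI impI)
      fix \<epsilon> :: real assume "\<epsilon> > 0"
      obtain a where a: "J z - \<epsilon> < real_of_rat a" "real_of_rat a < J z"
        using of_rat_dense[of "J z - \<epsilon>" "J z"] \<open>\<epsilon> > 0\<close> by auto
      obtain b where b: "J z < real_of_rat b" "real_of_rat b < J z + \<epsilon>"
        using of_rat_dense[of "J z" "J z + \<epsilon>"] \<open>\<epsilon> > 0\<close> by auto
      have "\<exists>\<^sub>F n in sequentially. (F ^^ n) z \<in> {z \<in> space flux. real_of_rat a < J z \<and> J z < real_of_rat b}"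
        using r z a b by blast
      then show "\<exists>\<^sub>F n in sequentially. \<bar>J ((F ^^ n) z) - J z\<bar> < \<epsilon>"
        by (rule frequently_elim1) (use a b in auto)
    qed
  qed
qed

end

section \<open>Fast particles in resonance\<close>

lemma AE_lborel_not_in_negligible:
  fixes S :: "'a::euclidean_space set"
  assumes "negligible S"
  shows "AE x in lborel. x \<notin> S"
proof -
  have "AE x in lebesgue. x \<notin> S"
    using assms by (intro AE_not_in) (simp add: negligible_iff_null_sets)
  then show ?thesis by (simp add: AE_completion_iff)
qed

lemma AE_lborel_affine:
  fixes P :: "real \<Rightarrow> bool"
  assumes "AE x in lborel. P x" "c \<noteq> 0"
  shows "AE x in lborel. P (t + c * x)"
proof -
  obtain N where N: "{x. \<not> P x} \<subseteq> N" "N \<in> null_sets lborel"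
    using assms(1) by (auto elim!: AE_E simp: null_sets_def)
  then have [measurable]: "N \<in> sets borel" by (auto simp: null_sets_def)
  have "AE x in lborel. t + c * x \<notin> N"
    by (rule AE_borel_affine[OF assms(2) _ AE_not_in[OF N(2)]]) measurable
  then show ?thesis by eventually_elim (use N in auto)
qed

section \<open>Collisions of a fast particle in resonance\<close>

locale resonant_accelerator = accelerator +
  fixes q :: nat
  assumes resonance: "(B - A) / A = real q"
begin

lemma B_eq: "B = (real q + 1) * A"
  using resonance A_pos by (simp add: field_simps)

lemma k_T_resonant: "k * T = real q * A"
  using k_T B_eq by (simp add: algebra_simps)

text \<open>A meeting in between, before or after the reflection at the fixed wall, would require
  the wall to have mean speed \<open>v\<close> over some interval; its Lipschitz constant
  \<open>k < v\<close> forbids this.\<close>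

lemma fast_collision:
  assumes z: "(t, v) \<in> X" and "k < v" "t < t1" and eq: "v * (t1 - t) = l t + l t1"
  shows "F (t, v) = (t1 rmod (2 * T), v - 2 * vel t1)"
proof -
  have late: "l t < v * (t1 - t)" using eq wall_dist_pos[of t1] by simp
  have "hit (t, v) = t1"
  proof (rule next_time_unique[OF z \<open>t < t1\<close>])
    show "pdist t v t1 = l t1" using eq wall_dist_pos[of t1] by simp
    fix s assume s: "t < s" "s < t1"
    have "k * (s - t) < v * (s - t)" "k * (t1 - s) < v * (t1 - s)"
      using s \<open>k < v\<close> by (auto intro: mult_strict_right_mono)
    moreover have "\<bar>l s - l t\<bar> \<le> k * (s - t)" "\<bar>l t1 - l s\<bar> \<le> k * (t1 - s)"
      using wall_dist_lipschitz[of s t] wall_dist_lipschitz[of t1 s] s by auto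
    moreover have "v * (t1 - t) = v * (t1 - s) + v * (s - t)" by (simp add: algebra_simps)
    ultimately show "pdist t v s \<noteq> l s" using eq by linarith
  qed
  then show ?thesis using late by (simp add: collision_map_eq impact_velocity_def)
qed

text \<open>
  The numbers \<open>a\<close> and \<open>b\<close> measure, in units of the constant gap between consecutive collisions, the
  conformal time \<open>\<integral> l\<^sup>-\<^sup>2\<close> until and since the moment at which the distance is minimal.
\<close>

definition approaching :: "real \<times> real \<Rightarrow> real \<Rightarrow> real \<Rightarrow> bool" where
  "approaching z a y \<longleftrightarrow> z \<in> X \<and> fst z \<le> T \<and>
     a = (T - fst z) * (snd z - k) / (2 * A) \<and> y = T * (snd z - k) / (2 * A)"

text \<open>In both definitions \<open>y\<close> is the speed relative to the wall in units of
  \<open>2 * A / T\<close>. A step on one side of the minimum changes it by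
  \<open>k * T / A\<close>, which resonance makes the integer \<open>q\<close>, and the turns leave
  it unchanged.\<close>

definition receding :: "real \<times> real \<Rightarrow> real \<Rightarrow> real \<Rightarrow> bool" where
  "receding z b y \<longleftrightarrow> z \<in> X \<and> T < fst z \<and>
     b = (fst z - T) * (snd z + k) / (2 * A) \<and> y = T * (snd z + k) / (2 * A)"

lemma wall_dist_first_period: "0 \<le> t \<Longrightarrow> t \<le> 2 * T \<Longrightarrow> l t = A + k * \<bar>t - T\<bar>"
  using wall_dist_cell[of 0 t] by simp

lemma wall_vel_first_period: "0 \<le> t \<Longrightarrow> t < 2 * T \<Longrightarrow> vel t = (if t \<le> T then - k else k)"
  using wall_vel_cell[of 0 t] by simp

lemma approachingD:
  assumes "approaching (t, v) a y"
  shows "(t, v) \<in> X" "0 \<le> t" "t \<le> T" "k < v" "2 * A * a = (T - t) * (v - k)" "2 * A * y = T * (v - k)" "0 \<le> a"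
proof -
  show "(t, v) \<in> X" "t \<le> T" using assms by (auto simp: approaching_def)
  then show t: "0 \<le> t" "k < v" using wall_vel_first_period[of t] T_pos by (auto simp: phase_cylinder_iff)
  show "2 * A * a = (T - t) * (v - k)" "2 * A * y = T * (v - k)"
    using assms A_pos by (auto simp: approaching_def)
  show "0 \<le> a" using assms A_pos t by (auto simp: approaching_def)
qed

lemma recedingD:
  assumes "receding (t, v) b y"
  shows "(t, v) \<in> X" "T < t" "t < 2 * T" "- k < v" "2 * A * b = (t - T) * (v + k)" "2 * A * y = T * (v + k)" "b < y"
proof -
  show t: "(t, v) \<in> X" "T < t" using assms by (auto simp: receding_def)
  then show t2: "t < 2 * T" "- k < v" using wall_vel_first_period[of t] T_pos by (auto simp: phase_cylinder_iff)
  show "2 * A * b = (t - T) * (v + k)" "2 * A * y = T * (v + k)"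
    using assms A_pos by (auto simp: receding_def)
  have "(t - T) * (v + k) < T * (v + k)" using t2 by (intro mult_strict_right_mono) auto
  then show "b < y" using assms A_pos by (auto simp: receding_def intro!: divide_strict_right_mono)
qed

lemma approachingI:
  assumes "z \<in> X" "z = (t, v)" "t \<le> T" "2 * A * a = (T - t) * (v - k)" "2 * A * y = T * (v - k)"
  shows "approaching z a y"
  using assms A_pos by (simp add: approaching_def eq_divide_eq mult.commute)

lemma recedingI:
  assumes "z \<in> X" "z = (t, v)" "T < t" "2 * A * b = (t - T) * (v + k)" "2 * A * y = T * (v + k)"
  shows "receding z b y"
  using assms A_pos by (simp add: receding_def eq_divide_eq mult.commute)

text \<open>Chosen so that a flight across a corner ends before the following corner.\<close>

definition threshold :: real where
  "threshold = k + 2 * B / T"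

lemma threshold:
  assumes "threshold < v"
  shows "k < v" "2 * A < T * (v - k)" "2 * B < T * (v + k)"
proof -
  have "0 < 2 * B / T" using A_pos A_less_B T_pos by simp
  then show "k < v" using assms by (simp add: threshold_def)
  have "2 * B / T < v - k" using assms by (simp add: threshold_def)
  then have "2 * B < T * (v - k)" using T_pos by (simp add: pos_divide_less_eq mult.commute)
  moreover have "T * (v - k) \<le> T * (v + k)" using T_pos k_pos by simp
  ultimately show "2 * A < T * (v - k)" "2 * B < T * (v + k)" using A_less_B by auto
qed

text \<open>The condition \<open>1 \<le> a\<close> says that the next collision still happens by the
  time \<open>T\<close>, the corner included.\<close>

lemma approaching_step:
  assumes "approaching z a y" "1 \<le> a"
  shows "approaching (F z) (a - 1) (y + real q)"
proof -
  obtain t v where z: "z = (t, v)" by (cases z)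
  note D = approachingD[OF assms(1)[unfolded z]]
  define x where "x = 2 * (A + k * (T - t)) / (v + k)"
  have vk: "0 < v + k" using D(4) k_pos by simp
  have xv: "x * (v + k) = 2 * (A + k * (T - t))" using vk by (simp add: x_def)
  have "0 < x" using vk A_pos k_pos D(3) by (simp add: x_def add_pos_nonneg)
  have "2 * A * 1 \<le> 2 * A * a" using assms(2) A_pos by (intro mult_left_mono) auto
  then have "x * (v + k) \<le> (T - t) * (v + k)" unfolding D(5) xv by (simp add: algebra_simps)
  then have x: "x \<le> T - t" using vk by simp
  have Fz: "F z = (t + x, v + 2 * k)"
  proof -
    have "F (t, v) = ((t + x) rmod (2 * T), v - 2 * vel (t + x))"
    proof (rule fast_collision[OF D(1,4)])
      show "v * (t + x - t) = l t + l (t + x)"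
        using xv D(2,3) x \<open>0 < x\<close> by (simp add: wall_dist_first_period algebra_simps)
    qed (use \<open>0 < x\<close> in simp)
    then show ?thesis using D(2,3) x \<open>0 < x\<close> T_pos by (simp add: z wall_vel_first_period)
  qed
  show ?thesis
  proof (rule approachingI[OF _ Fz])
    show "F z \<in> X" using collision_map_in_phase_cylinder D(1) z by simp
    show "t + x \<le> T" using x by simp
    show "2 * A * (a - 1) = (T - (t + x)) * (v + 2 * k - k)"
      using D(5) xv by (simp add: algebra_simps)
    show "2 * A * (y + real q) = T * (v + 2 * k - k)"
      using D(6) k_T_resonant by (simp add: algebra_simps)
  qed
qed

text \<open>The unit gap that contains the minimal distance splits into \<open>a\<close> before and
  \<open>1 - a\<close> after it.\<close>

lemma approaching_turn:
  assumes "approaching z a y" "a < 1" "threshold < snd z"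
  shows "receding (F z) (1 - a) y"
proof -
  obtain t v where z: "z = (t, v)" by (cases z)
  note D = approachingD[OF assms(1)[unfolded z]]
  note th = threshold[of v] assms(3)[unfolded z snd_conv]
  define x where "x = 2 * A / (v - k) - (T - t)"
  have vk: "0 < v - k" using D(4) by simp
  have xv: "x * (v - k) = 2 * A - (T - t) * (v - k)" using vk unfolding x_def left_diff_distrib by simp
  have "2 * A * a < 2 * A * 1" using assms(2) A_pos by (intro mult_strict_left_mono) auto
  then have "0 * (v - k) < x * (v - k)" unfolding D(5) xv by simp
  then have "0 < x" using vk by (simp add: zero_less_mult_iff)
  have "x * (v - k) < T * (v - k)"
    using th D(3) vk unfolding xv by (smt (verit) mult_nonneg_nonneg)
  then have x: "x < T" using vk by simp
  have Fz: "F z = (T + x, v - 2 * k)"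
  proof -
    have "F (t, v) = ((T + x) rmod (2 * T), v - 2 * vel (T + x))"
    proof (rule fast_collision[OF D(1,4)])
      show "v * (T + x - t) = l t + l (T + x)"
        using xv D(2,3) x \<open>0 < x\<close> by (simp add: wall_dist_first_period algebra_simps)
    qed (use \<open>0 < x\<close> D(3) in simp)
    then show ?thesis using x \<open>0 < x\<close> T_pos by (simp add: z wall_vel_first_period)
  qed
  show ?thesis
  proof (rule recedingI[OF _ Fz])
    show "F z \<in> X" using collision_map_in_phase_cylinder D(1) z by simp
    show "T < T + x" using \<open>0 < x\<close> by simp
    show "2 * A * (1 - a) = (T + x - T) * (v - 2 * k + k)"
      using D(5) xv by (simp add: algebra_simps)
    show "2 * A * y = T * (v - 2 * k + k)" using D(6) by simp
  qed
qed

text \<open>\<open>2 * A * (y - b) = (2 * T - t) * (v + k)\<close> measures the time left to the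
  corner \<open>2 * T\<close>. A step lowers \<open>y - b\<close> by \<open>q + 1\<close> and takes
  place before the corner if \<open>y - b\<close> exceeds \<open>q + 1\<close>.\<close>

lemma receding_step:
  assumes "receding z b y" "real q + 1 < y - b" "k < snd z"
  shows "receding (F z) (b + 1) (y - real q)"
proof -
  obtain t v where z: "z = (t, v)" by (cases z)
  note D = recedingD[OF assms(1)[unfolded z]]
  have vk: "0 < v - k" using assms(3) z by simp
  define x where "x = 2 * (A + k * (t - T)) / (v - k)"
  have xv: "x * (v - k) = 2 * (A + k * (t - T))" using vk by (simp add: x_def)
  have "0 < x" using vk A_pos k_pos D(2) by (simp add: x_def add_pos_nonneg)
  have "2 * A * (b + real q + 1) < 2 * A * y" using assms(2) A_pos by (intro mult_strict_left_mono) auto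
  then have "(t - T + x) * (v - k) < T * (v - k)"
    using D(5,6) xv k_T_resonant by (simp add: algebra_simps)
  then have x: "t + x < 2 * T" using vk by simp
  have Fz: "F z = (t + x, v - 2 * k)"
  proof -
    have "F (t, v) = ((t + x) rmod (2 * T), v - 2 * vel (t + x))"
    proof (rule fast_collision[OF D(1)])
      show "v * (t + x - t) = l t + l (t + x)"
        using xv D(2,3) x \<open>0 < x\<close> T_pos by (simp add: wall_dist_first_period algebra_simps)
    qed (use \<open>0 < x\<close> vk in auto)
    then show ?thesis using D(2,3) x \<open>0 < x\<close> T_pos by (simp add: z wall_vel_first_period)
  qed
  show ?thesis
  proof (rule recedingI[OF _ Fz])
    show "F z \<in> X" using collision_map_in_phase_cylinder D(1) z by simp
    show "T < t + x" using D(2) \<open>0 < x\<close> by simp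
    show "2 * A * (b + 1) = (t + x - T) * (v - 2 * k + k)"
      using D(5) xv by (simp add: algebra_simps)
    show "2 * A * (y - real q) = T * (v - 2 * k + k)"
      using D(6) k_T_resonant by (simp add: algebra_simps)
  qed
qed

text \<open>Resonance enters through \<open>2 * B = (q + 1) * (2 * A)\<close>. Equality in
  \<open>y - b \<le> q + 1\<close> is a collision exactly at the corner, which counts as the start
  of the inward piece.\<close>

lemma receding_turn:
  assumes "receding z b y" "y - b \<le> real q + 1" "threshold < snd z"
  shows "approaching (F z) (2 * y - (real q + 1) - b) y"
proof -
  obtain t v where z: "z = (t, v)" by (cases z)
  note D = recedingD[OF assms(1)[unfolded z]]
  note th = threshold[of v] assms(3)[unfolded z snd_conv]
  define x where "x = 2 * B / (v + k) - (2 * T - t)"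
  have vk: "0 < v + k" using D(4) by simp
  have kv: "k < v" using th by blast
  have xv: "x * (v + k) = 2 * B - (2 * T - t) * (v + k)" using vk unfolding x_def left_diff_distrib by simp
  have "2 * A * (y - b) \<le> 2 * A * (real q + 1)" using assms(2) A_pos by (intro mult_left_mono) auto
  then have "0 * (v + k) \<le> x * (v + k)" using D(5,6) B_eq unfolding xv by (simp add: algebra_simps)
  then have "0 \<le> x" using vk by (simp add: zero_le_mult_iff)
  have "x * (v + k) < T * (v + k)"
    using th D(3) vk unfolding xv by (smt (verit) mult_nonneg_nonneg)
  then have x: "x < T" using vk by simp
  have Fz: "F z = (x, v + 2 * k)"
  proof -
    have l1: "l (2 * T + x) = A + k * (T - x)"
      using wall_dist_periodic[of x 1] wall_dist_first_period[of x] x \<open>0 \<le> x\<close> T_pos by (simp add: add.commute)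
    have "F (t, v) = ((2 * T + x) rmod (2 * T), v - 2 * vel (2 * T + x))"
    proof (rule fast_collision[OF D(1) kv])
      show "v * (2 * T + x - t) = l t + l (2 * T + x)"
        using xv D(2,3) k_T unfolding l1 by (simp add: wall_dist_first_period algebra_simps)
    qed (use \<open>0 \<le> x\<close> D(3) in simp)
    moreover have "(2 * T + x) rmod (2 * T) = x" using x \<open>0 \<le> x\<close> T_pos by (intro rmod_unique[of _ _ _ 1]) auto
    moreover have "vel (2 * T + x) = - k"
      using wall_vel_periodic[of x 1] wall_vel_first_period[of x] x \<open>0 \<le> x\<close> T_pos by (simp add: add.commute)
    ultimately show ?thesis by (simp add: z)
  qed
  show ?thesis
  proof (rule approachingI[OF _ Fz])
    show "F z \<in> X" using collision_map_in_phase_cylinder D(1) z by simp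
    show "x \<le> T" using x by simp
    show "2 * A * (2 * y - (real q + 1) - b) = (T - x) * (v + 2 * k - k)"
      using D(5,6) xv B_eq by (simp add: algebra_simps)
    show "2 * A * y = T * (v + 2 * k - k)" using D(6) by simp
  qed
qed

definition fast :: "real \<times> real \<Rightarrow> bool" where
  "fast z \<longleftrightarrow> (\<forall>n. threshold < snd ((F ^^ n) z))"

lemma fast_funpow: "fast z \<Longrightarrow> fast ((F ^^ n) z)"
  unfolding fast_def by (metis comp_apply funpow_add)

lemma fastD: "fast z \<Longrightarrow> threshold < snd z"
  unfolding fast_def by (metis funpow_0)

lemma approaching_iterate:
  "approaching z a y \<Longrightarrow> real n \<le> a \<Longrightarrow> approaching ((F ^^ n) z) (a - real n) (y + real q * real n)"
proof (induction n)
  case (Suc n)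
  then have "approaching ((F ^^ n) z) (a - real n) (y + real q * real n)" by simp
  from approaching_step[OF this] Suc(3) show ?case by (simp add: algebra_simps)
qed simp

lemma receding_iterate:
  "fast z \<Longrightarrow> receding z b y \<Longrightarrow> (real q + 1) * real n < y - b \<Longrightarrow>
   receding ((F ^^ n) z) (b + real n) (y - real q * real n)"
proof (induction n)
  case (Suc n)
  have "(real q + 1) * real n \<le> (real q + 1) * real (Suc n)" by (intro mult_left_mono) auto
  then have "(real q + 1) * real n < y - b" using Suc.prems(3) by linarith
  then have "receding ((F ^^ n) z) (b + real n) (y - real q * real n)" by (rule Suc.IH[OF Suc.prems(1,2)])
  from receding_step[OF this] Suc.prems(3) threshold(1)[OF fastD[OF fast_funpow[OF Suc.prems(1), of n]]]
  show ?case by (simp add: algebra_simps)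
qed simp

lemma approaching_to_section:
  assumes "approaching z a y"
  shows "approaching ((F ^^ nat \<lfloor>a\<rfloor>) z) (a - \<lfloor>a\<rfloor>) (y + real q * \<lfloor>a\<rfloor>)"
proof -
  have "0 \<le> a" using assms by (cases z) (auto dest: approachingD)
  then have "real (nat \<lfloor>a\<rfloor>) = real_of_int \<lfloor>a\<rfloor>" by simp
  then show ?thesis using approaching_iterate[OF assms, of "nat \<lfloor>a\<rfloor>"] by simp
qed

section \<open>The period map and its bounded returns\<close>

text \<open>The section consists of approaching states with \<open>\<phi> < 1\<close>. Here
  \<open>f\<close> is the number of receding steps and \<open>r\<close> the value of
  \<open>y - b\<close> left when the upper corner is crossed. The new \<open>a\<close> is
  \<open>2 * r - \<phi>\<close> up to an integer, and its floor counts the approaching steps that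
  follow.\<close>

lemma section_return:
  fixes f :: int and r U \<phi> :: real
  assumes fast: "fast z" and sec: "approaching z \<phi> U" "\<phi> < 1"
    and r: "r = U - 1 + \<phi> - (real q + 1) * f" "0 < r" "r < real q + 1"
  shows "\<exists>n>0. approaching ((F ^^ n) z) (2 * r - \<phi> - \<lfloor>2 * r - \<phi>\<rfloor>) (U + real q * (\<lfloor>2 * r - \<phi>\<rfloor> - real q))"
proof -
  have rec: "receding (F z) (1 - \<phi>) U" using approaching_turn[OF sec fastD[OF fast]] .
  then have "1 - \<phi> < U" by (cases "F z") (auto dest: recedingD)
  then have "(real q + 1) * (-1) < (real q + 1) * real_of_int f" using r by simp
  then have "-1 < real_of_int f" by (subst (asm) mult_less_cancel_left_pos) auto
  then have "0 \<le> f" by simp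
  then have f: "real (nat f) = real_of_int f" by simp
  define z1 where "z1 = (F ^^ nat f) (F z)"
  have fz: "fast (F z)" using fast_funpow[OF fast, of 1] by simp
  have z1: "receding z1 (1 - \<phi> + f) (U - real q * f)"
    using receding_iterate[OF fz rec, of "nat f"] r f by (simp add: z1_def)
  have fz1: "fast z1" unfolding z1_def by (rule fast_funpow[OF fz])
  let ?a = "2 * r - \<phi> + real_of_int (f - int q)"
  have a: "2 * (U - real q * f) - (real q + 1) - (1 - \<phi> + f) = ?a"
    using r by (simp add: algebra_simps)
  have "approaching (F z1) (2 * (U - real q * f) - (real q + 1) - (1 - \<phi> + f)) (U - real q * f)"
    by (rule receding_turn[OF z1 _ fastD[OF fz1]]) (use r in \<open>simp add: algebra_simps\<close>)
  then have "approaching (F z1) ?a (U - real q * f)" unfolding a .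
  from approaching_to_section[OF this]
  have "approaching ((F ^^ nat \<lfloor>?a\<rfloor>) (F z1)) (?a - \<lfloor>?a\<rfloor>) (U - real q * f + real q * \<lfloor>?a\<rfloor>)" .
  moreover have fl: "\<lfloor>?a\<rfloor> = \<lfloor>2 * r - \<phi>\<rfloor> + (f - int q)" by (rule floor_add_int[symmetric])
  have "?a - \<lfloor>?a\<rfloor> = 2 * r - \<phi> - \<lfloor>2 * r - \<phi>\<rfloor>" unfolding fl by simp
  moreover have "U - real q * f + real q * \<lfloor>?a\<rfloor> = U + real q * (\<lfloor>2 * r - \<phi>\<rfloor> - real q)"
    unfolding fl by (simp add: algebra_simps)
  moreover have "(F ^^ nat \<lfloor>?a\<rfloor>) (F z1) = (F ^^ (nat \<lfloor>?a\<rfloor> + Suc (nat f + 1))) z"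
    by (simp add: z1_def funpow_add funpow_swap1)
  ultimately show ?thesis by (metis add_Suc_right zero_less_Suc)
qed

lemma strictly_between_floor_line:
  fixes h :: int and Q :: nat and x :: real
  assumes "0 < Q" "h < real Q * x" "real Q * x < h + 1"
  shows "h div int Q < x" "x < h div int Q + 1"
proof -
  have "int Q * (h div int Q) = h - h mod int Q" by (simp add: minus_mod_eq_mult_div)
  moreover have "0 \<le> h mod int Q" "h mod int Q < int Q" using assms(1) by auto
  ultimately have "int Q * (h div int Q) \<le> h" "h + 1 \<le> int Q * (h div int Q + 1)"
    unfolding distrib_left by linarith+
  then have "real_of_int (int Q * (h div int Q)) \<le> real_of_int h"
    "real_of_int (h + 1) \<le> real_of_int (int Q * (h div int Q + 1))" by linarith+
  then have "real Q * real_of_int (h div int Q) < real Q * x" "real Q * x < real Q * (real_of_int (h div int Q) + 1)"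
    using assms(2,3) by auto
  then show "h div int Q < x" "x < h div int Q + 1" using assms(1) by auto
qed

text \<open>Along the itinerary the roundings of the period map are those of the rational rotation:
  \<open>M\<close> determines the remainder modulo \<open>q + 1\<close> and \<open>N\<close> the
  floor, so \<open>j\<close> obeys the recursion of \<open>drift_over_resonant_period\<close>. An
  upper bound on \<open>U'\<close> at late times already contradicts escape.\<close>

lemma section_bounded_return:
  assumes fast: "fast z" and sec: "approaching z \<phi> U" "\<phi> < 1"
    and itin: "resonant_itinerary q U \<phi> P Q g g'"
  shows "\<exists>n\<ge>Q. \<exists>\<phi>' U'. approaching ((F ^^ n) z) \<phi>' U' \<and> U' \<le> U + 3 * real (q * Suc q)"
proof -
  have PQ: "0 < Q" "even Q" "odd P" "coprime P (int Q)" using itin by (auto simp: resonant_itinerary_def)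
  define N where "N = (\<lambda>i::nat. (g + int i * P) div int Q)"
  define M where "M = (\<lambda>i::nat. (g' + int i * P) div int Q)"
  define j where "j = rec_nat 0 (\<lambda>i j. j + int q * ((N (Suc i) - N i) - 2 * (M i - N i)
        + 2 * ((j - 1 + (M i - N i)) mod int (Suc q)) - int q))"
  have j0: "j 0 = 0" by (simp add: j_def)
  have jSuc: "j (Suc i) = j i + int q * ((N (Suc i) - N i) - 2 * (M i - N i)
        + 2 * ((j i - 1 + (M i - N i)) mod int (Suc q)) - int q)" for i
    by (simp add: j_def)
  have N: "N i < \<phi> + 2 * real i * U" "\<phi> + 2 * real i * U < N i + 1"
    and M: "M i < \<phi> + U + 2 * real i * U" "\<phi> + U + 2 * real i * U < M i + 1"
    if "i \<le> Suc q * Q" for i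
    using itin that strictly_between_floor_line[OF PQ(1)] unfolding N_def M_def resonant_itinerary_def by auto
  have orbit: "i \<le> Suc q * Q \<Longrightarrow> \<exists>n\<ge>i. approaching ((F ^^ n) z) (\<phi> + 2 * real i * U - N i) (U + j i)" for i
  proof (induction i)
    case 0
    have "0 \<le> \<phi>" using sec by (cases z) (auto dest: approachingD)
    then have "N 0 = 0" using N[of 0] sec(2) by simp
    then show ?case using sec j0 by (intro exI[of _ 0]) simp
  next
    case (Suc i)
    then obtain n where n: "n \<ge> i" "approaching ((F ^^ n) z) (\<phi> + 2 * real i * U - N i) (U + j i)" by auto
    let ?\<phi> = "\<phi> + 2 * real i * U - N i"
    \<comment> \<open>\<open>e\<close> is the floor of \<open>U + j i - 1 + ?\<phi>\<close>, so
      \<open>f\<close> is the quotient that \<open>section_return\<close> asks for.\<close>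
    define e where "e = j i - 1 + (M i - N i)"
    define f where "f = e div int (Suc q)"
    define r where "r = U + j i - 1 + ?\<phi> - (real q + 1) * f"
    have ef: "e = int (Suc q) * f + e mod int (Suc q)" unfolding f_def by simp
    have ef': "real_of_int e = (real q + 1) * f + real_of_int (e mod int (Suc q))"
      by (subst ef) simp
    have "e mod int (Suc q) < int (Suc q)" by simp
    then have "0 \<le> e mod int (Suc q)" "e mod int (Suc q) \<le> int q" by (simp, linarith)
    then have mod: "0 \<le> real_of_int (e mod int (Suc q))" "real_of_int (e mod int (Suc q)) \<le> real q" by linarith+
    have r_eq: "r = (\<phi> + U + 2 * real i * U - M i) + real_of_int (e mod int (Suc q))"
      using ef' by (simp add: r_def e_def)
    have r: "0 < r" "r < real q + 1" unfolding r_eq using M[OF less_imp_le[OF Suc_le_lessD[OF Suc.prems]]] mod by linarith+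
    define m where "m = (N (Suc i) - N i) + 2 * j i - 2 - 2 * int (Suc q) * f"
    have fr: "2 * r - ?\<phi> - m = \<phi> + 2 * real (Suc i) * U - N (Suc i)"
      by (simp add: r_def m_def algebra_simps)
    have m: "\<lfloor>2 * r - ?\<phi>\<rfloor> = m"
      using N[OF Suc.prems] fr by (intro floor_unique) linarith+
    have next_j: "U + j i + real q * (m - real q) = U + j (Suc i)"
    proof -
      have "m - int q = (N (Suc i) - N i) - 2 * (M i - N i) + 2 * (e mod int (Suc q)) - int q"
      proof -
        have "2 * int (Suc q) * f = 2 * (int (Suc q) * f)" by (rule mult.assoc)
        moreover have "2 * j i - 2 = 2 * e - 2 * (M i - N i)" by (simp add: e_def)
        ultimately show ?thesis unfolding m_def using ef by linarith
      qed
      then have "j (Suc i) = j i + int q * (m - int q)" by (simp add: jSuc e_def)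
      then show ?thesis by simp
    qed
    have "?\<phi> < 1" using N[of i] Suc.prems by simp
    from section_return[OF fast_funpow[OF fast, of n] n(2) this r_def r] obtain n' where n':
      "n' > 0" "approaching ((F ^^ n') ((F ^^ n) z)) (2 * r - ?\<phi> - \<lfloor>2 * r - ?\<phi>\<rfloor>) (U + j i + real q * (\<lfloor>2 * r - ?\<phi>\<rfloor> - real q))"
      by blast
    then have "approaching ((F ^^ (n' + n)) z) (\<phi> + 2 * real (Suc i) * U - N (Suc i)) (U + j (Suc i))"
      unfolding m fr next_j by (simp add: funpow_add)
    then show ?case using n(1) n'(1) by (intro exI[of _ "n' + n"]) auto
  qed
  obtain n where n: "n \<ge> Suc q * Q"
    "approaching ((F ^^ n) z) (\<phi> + 2 * real (Suc q * Q) * U - N (Suc q * Q)) (U + j (Suc q * Q))"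
    using orbit[of "Suc q * Q"] by auto
  have jL: "j (Suc q * Q) = int (q * Suc q) * (P - 2 * (g' - g))"
    using drift_over_resonant_period[OF PQ(4,1,2,3), of N g M g' j q] jSuc j0 by (simp add: N_def M_def)
  \<comment> \<open>This is the second difference of the floors of \<open>Q * \<phi>\<close>,
    \<open>Q * (\<phi> + U)\<close> and \<open>Q * (\<phi> + 2 * U)\<close>. The points are equally
    spaced, so only rounding errors remain.\<close>
  have "P - 2 * (g' - g) \<le> 3"
  proof -
    have "g < real Q * \<phi>" "real Q * \<phi> < g + 1" "g' < real Q * (\<phi> + U)" "real Q * (\<phi> + U) < g' + 1"
      using itin unfolding resonant_itinerary_def by (auto dest!: spec[of _ 0])
    moreover have "g + P < real Q * (\<phi> + 2 * U)"
    proof -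
      have "1 \<le> Suc q * Q" using PQ(1) by simp
      then show ?thesis using itin unfolding resonant_itinerary_def by (auto dest!: spec[of _ 1])
    qed
    ultimately have "real_of_int (P - 2 * (g' - g)) < 4" by (simp add: algebra_simps)
    then show ?thesis by linarith
  qed
  then have "j (Suc q * Q) \<le> int (q * Suc q) * 3" unfolding jL by (intro mult_left_mono) auto
  then have "real_of_int (j (Suc q * Q)) \<le> real_of_int (int (q * Suc q) * 3)" by linarith
  then have "U + j (Suc q * Q) \<le> U + 3 * real (q * Suc q)" by simp
  moreover have "Q \<le> n" using n(1) by simp
  ultimately show ?thesis using n(2) by blast
qed

lemma reaches_section:
  assumes "fast z" "z \<in> X"
  shows "\<exists>n \<phi> U. approaching ((F ^^ n) z) \<phi> U \<and> \<phi> < 1"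
proof -
  have to_section: "\<exists>n \<phi> U. approaching ((F ^^ n) z) \<phi> U \<and> \<phi> < 1" if "approaching ((F ^^ m) z) a y" for m a y
  proof -
    have "approaching ((F ^^ (nat \<lfloor>a\<rfloor> + m)) z) (a - \<lfloor>a\<rfloor>) (y + real q * \<lfloor>a\<rfloor>)"
      using approaching_to_section[OF that] by (simp add: funpow_add)
    moreover have "a - \<lfloor>a\<rfloor> < 1" by linarith
    ultimately show ?thesis by blast
  qed
  show ?thesis
  proof (cases "fst z \<le> T")
    case True
    then have "approaching ((F ^^ 0) z) ((T - fst z) * (snd z - k) / (2 * A)) (T * (snd z - k) / (2 * A))"
      using assms by (simp add: approaching_def)
    then show ?thesis by (rule to_section)
  next
    case False
    define b where "b = (fst z - T) * (snd z + k) / (2 * A)"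
    define y where "y = T * (snd z + k) / (2 * A)"
    have rec: "receding z b y" using assms False by (simp add: receding_def b_def y_def)
    then have "b < y" by (cases z) (auto dest: recedingD)
    \<comment> \<open>The ceiling leaves a remainder of \<open>y - b\<close> above 0 and at most
      \<open>q + 1\<close>, the range in which \<open>receding_turn\<close> applies.\<close>
    define m where "m = \<lceil>(y - b) / (real q + 1)\<rceil> - 1"
    have "0 < (y - b) / (real q + 1)" using \<open>b < y\<close> by simp
    then have "0 \<le> m" unfolding m_def by linarith
    have "m < (y - b) / (real q + 1)" "(y - b) / (real q + 1) \<le> m + 1" unfolding m_def by linarith+
    then have m: "(real q + 1) * m < y - b" "y - b \<le> (real q + 1) * (m + 1)"
      by (auto simp: pos_less_divide_eq pos_divide_le_eq mult.commute)
    have "receding ((F ^^ nat m) z) (b + m) (y - real q * m)"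
      using receding_iterate[OF assms(1) rec, of "nat m"] m \<open>0 \<le> m\<close> by simp
    from receding_turn[OF this _ fastD[OF fast_funpow[OF assms(1)]]] m
    have "approaching ((F ^^ Suc (nat m)) z) (2 * (y - real q * m) - (real q + 1) - (b + m)) (y - real q * m)"
      by (simp add: algebra_simps)
    then show ?thesis by (rule to_section)
  qed
qed

section \<open>The exceptional null set and the absence of escape\<close>

text \<open>The formulas for \<open>U\<close> and \<phi> of an approaching state, read on the whole
  phase cylinder; only their values at section states matter later.\<close>

definition exceptional :: "(real \<times> real) set" where
  "exceptional = {z \<in> X. \<not> resonant_phase q (T * (snd z - k) / (2 * A)) ((T - fst z) * (snd z - k) / (2 * A))}"

text \<open>On the phase cylinder \<open>v > - k\<close>, so a large energy can only come from a
  large positive velocity.\<close>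

lemma snd_large_if_energy_large:
  assumes z: "z \<in> X" and e: "filterlim (\<lambda>n. energy ((F ^^ n) z)) at_top sequentially"
  shows "\<forall>\<^sub>F n in sequentially. C < snd ((F ^^ n) z)"
proof -
  define D where "D = \<bar>C\<bar> + k"
  have "\<forall>\<^sub>F n in sequentially. D\<^sup>2 / 2 < energy ((F ^^ n) z)"
    using e unfolding filterlim_at_top_dense by blast
  then show ?thesis
  proof eventually_elim
    case (elim n)
    obtain t v where tv: "(F ^^ n) z = (t, v)" by (cases "(F ^^ n) z")
    have "(t, v) \<in> X" using collision.funpow_space[of z n] z tv by simp
    then have v: "- k < v" using wall_vel_cases[of t] k_pos by (auto simp: phase_cylinder_iff)
    have "\<bar>D\<bar> < \<bar>v\<bar>"
      using elim abs_le_square_iff[of v D] unfolding tv energy_def by (simp add: not_le[symmetric])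
    then show ?case using v tv k_pos by (auto simp: D_def abs_if split: if_splits)
  qed
qed

text \<open>An escaping orbit is eventually fast and reaches the section. A resonant phase there
  would bring the velocity down to at most \<open>C\<close> at arbitrarily late times.\<close>

lemma escaping_visits_exceptional:
  assumes "z \<in> escaping_set A B T"
  shows "\<exists>n. (F ^^ n) z \<in> exceptional"
proof (rule ccontr)
  assume no: "\<nexists>n. (F ^^ n) z \<in> exceptional"
  have z: "z \<in> X" and e: "filterlim (\<lambda>n. energy ((F ^^ n) z)) at_top sequentially"
    using assms by (auto simp: escaping_set_def)
  obtain n0 where n0: "\<And>n. n \<ge> n0 \<Longrightarrow> threshold < snd ((F ^^ n) z)"
    using snd_large_if_energy_large[OF z e] by (auto simp: eventually_sequentially)
  have fast0: "fast ((F ^^ n0) z)"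
    unfolding fast_def using n0 by (metis comp_apply funpow_add le_add2)
  have "(F ^^ n0) z \<in> X" using collision.funpow_space[of z n0] z by simp
  from reaches_section[OF fast0 this] obtain n \<phi> U where
    n: "approaching ((F ^^ n) ((F ^^ n0) z)) \<phi> U" "\<phi> < 1" by blast
  define w where "w = (F ^^ (n + n0)) z"
  have sec: "approaching w \<phi> U" using n(1) by (simp add: w_def funpow_add)
  have fw: "fast w" using fast_funpow[OF fast0, of n] by (simp add: w_def funpow_add)
  have "w \<notin> exceptional" using no by (auto simp: w_def)
  then have res: "resonant_phase q U \<phi>" using sec by (auto simp: approaching_def exceptional_def)
  define C where "C = k + 2 * A * (U + 3 * real (q * Suc q)) / T"
  obtain N where N: "\<And>m. m \<ge> N \<Longrightarrow> C < snd ((F ^^ m) z)"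
    using snd_large_if_energy_large[OF z e] by (auto simp: eventually_sequentially)
  obtain Q P g g' where Q: "Q \<ge> N" "resonant_itinerary q U \<phi> P Q g g'"
    using res unfolding resonant_phase_def by blast
  obtain m \<phi>' U' where m: "m \<ge> Q" "approaching ((F ^^ m) w) \<phi>' U'" "U' \<le> U + 3 * real (q * Suc q)"
    using section_bounded_return[OF fw sec n(2) Q(2)] by blast
  have "2 * A * U' = T * (snd ((F ^^ m) w) - k)"
    using m(2) by (cases "(F ^^ m) w") (auto dest: approachingD)
  then have "T * (snd ((F ^^ m) w) - k) \<le> 2 * A * (U + 3 * real (q * Suc q))"
    using m(3) A_pos by (metis mult_left_mono mult_pos_pos less_imp_le zero_less_numeral)
  then have "snd ((F ^^ m) w) - k \<le> 2 * A * (U + 3 * real (q * Suc q)) / T"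
    using T_pos by (simp add: pos_le_divide_eq mult.commute)
  then have "snd ((F ^^ m) w) \<le> C" by (simp add: C_def)
  moreover have "(F ^^ m) w = (F ^^ (m + (n + n0))) z" by (simp add: w_def funpow_add)
  moreover have "m + (n + n0) \<ge> N" using m(1) Q(1) by simp
  ultimately show False using N[of "m + (n + n0)"] by simp
qed

lemma measurable_resonant_phase:
  "Measurable.pred (borel \<Otimes>\<^sub>M borel) (\<lambda>z. resonant_phase q (fst z) (snd z))"
  unfolding resonant_phase_def resonant_itinerary_def by measurable

text \<open>Fubini on the lines of constant \<open>v\<close>: the rotation angle is fixed there and
  affine in \<open>v\<close>, and the phase is affine in \<open>t\<close>, so null sets of angles
  and of phases transfer. The line \<open>v = k\<close>, where the phase degenerates, is set
  aside.\<close>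

lemma AE_not_exceptional: "AE z in lborel. z \<notin> exceptional"
proof -
  let ?P = "\<lambda>t v. v \<noteq> k \<longrightarrow> resonant_phase q (T * (v - k) / (2 * A)) ((T - t) * (v - k) / (2 * A))"
  have "AE \<alpha> in lborel. \<forall>\<epsilon>>0. \<forall>N. \<exists>P. \<exists>Q\<ge>N. odd_even_approx \<alpha> \<epsilon> P Q"
    using AE_lborel_not_in_negligible[OF negligible_not_odd_even_approx] by simp
  from AE_lborel_affine[OF this, of "T / A" "- (T * k / A)"]
  have "AE v in lborel. \<forall>\<epsilon>>0. \<forall>N. \<exists>P. \<exists>Q\<ge>N. odd_even_approx (- (T * k / A) + T / A * v) \<epsilon> P Q"
    using T_pos A_pos by simp
  then have sections: "AE v in lborel. AE t in lborel. ?P t v"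
  proof eventually_elim
    case (elim v)
    let ?\<sigma> = "T * (v - k) / (2 * A)"
    have eq: "- (T * k / A) + T / A * v = 2 * ?\<sigma>" by (simp add: diff_divide_distrib right_diff_distrib)
    have "negligible {\<phi>. \<not> resonant_phase q ?\<sigma> \<phi>}"
      by (rule negligible_not_resonant_phase) (use elim in \<open>simp only: eq\<close>)
    then have "AE \<phi> in lborel. resonant_phase q ?\<sigma> \<phi>"
      using AE_lborel_not_in_negligible by fastforce
    then show ?case
    proof (cases "v = k")
      case False
      have c: "- ((v - k) / (2 * A)) \<noteq> 0" using False A_pos by simp
      have "AE t in lborel. resonant_phase q ?\<sigma> (?\<sigma> + - ((v - k) / (2 * A)) * t)"
        by (rule AE_lborel_affine[OF _ c]) fact
      moreover have "?\<sigma> + - ((v - k) / (2 * A)) * t = (T - t) * (v - k) / (2 * A)" for t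
        using A_pos by (simp add: field_simps)
      ultimately show ?thesis by simp
    qed simp
  qed
  have [measurable]: "Measurable.pred (borel \<Otimes>\<^sub>M borel) (\<lambda>z. ?P (fst z) (snd z))"
  proof -
    have "Measurable.pred (borel \<Otimes>\<^sub>M borel)
        (\<lambda>z. resonant_phase q (T * (snd z - k) / (2 * A)) ((T - fst z) * (snd z - k) / (2 * A)))"
      using measurable_compose[OF _ measurable_resonant_phase,
          of "\<lambda>z. (T * (snd z - k) / (2 * A), (T - fst z) * (snd z - k) / (2 * A))" "borel \<Otimes>\<^sub>M borel"]
      by simp
    then show ?thesis by measurable
  qed
  have meas: "{z \<in> space (lborel \<Otimes>\<^sub>M lborel). ?P (fst z) (snd z)} \<in> sets (lborel \<Otimes>\<^sub>M lborel)"
  proof -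
    have "{z \<in> space (borel \<Otimes>\<^sub>M borel). ?P (fst z) (snd z)} \<in> sets (borel \<Otimes>\<^sub>M borel)" by measurable
    then show ?thesis by (simp add: space_pair_measure cong: sets_pair_measure_cong)
  qed
  have "AE t in lborel. AE v in lborel. ?P t v"
    using lborel_pair.AE_commute[OF meas] sections by simp
  then have "AE z in lborel \<Otimes>\<^sub>M lborel. ?P (fst z) (snd z)"
    by (intro lborel_pair.AE_pair_measure meas) simp
  then have 1: "AE z in lborel. ?P (fst z) (snd z)" by (simp only: lborel_prod)
  have "AE t in lborel. AE v in lborel. v \<noteq> k"
    using AE_lborel_singleton[of k] by simp
  moreover have "{z \<in> space (lborel \<Otimes>\<^sub>M lborel :: (real \<times> real) measure). snd z \<noteq> k} \<in> sets (lborel \<Otimes>\<^sub>M lborel)"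
  proof -
    have "{z \<in> space (borel \<Otimes>\<^sub>M borel :: (real \<times> real) measure). snd z \<noteq> k} \<in> sets (borel \<Otimes>\<^sub>M borel)"
      by measurable
    then show ?thesis by (simp add: space_pair_measure cong: sets_pair_measure_cong)
  qed
  ultimately have "AE z in (lborel \<Otimes>\<^sub>M lborel :: (real \<times> real) measure). snd z \<noteq> k"
    by (intro lborel_pair.AE_pair_measure) simp_all
  then have 2: "AE z in (lborel :: (real \<times> real) measure). snd z \<noteq> k" unfolding lborel_prod .
  from 1 2 show ?thesis by eventually_elim (auto simp: exceptional_def)
qed

text \<open>Invariance of the flux turns a Borel null set around the exceptional states into a null
  set of orbits that ever meet it.\<close>

lemma AE_not_escaping: "AE z in flux. z \<notin> escaping_set A B T"
proof -
  obtain N where N: "{z \<in> space lborel. \<not> z \<notin> exceptional} \<subseteq> N" "N \<in> null_sets lborel"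
    using AE_not_exceptional by (auto elim!: AE_E simp: null_sets_def)
  let ?N = "N \<inter> X"
  have "?N \<in> sets flux" using N(2) phase_cylinder_sets by (auto simp: sets_flux null_sets_def)
  moreover have "emeasure flux ?N = 0"
  proof -
    have "AE z in flux. z \<notin> ?N" unfolding AE_flux_iff using AE_not_in[OF N(2)] by eventually_elim auto
    then show ?thesis using \<open>?N \<in> sets flux\<close> by (subst (asm) AE_iff_measurable[of ?N]) auto
  qed
  ultimately have "AE z in flux. \<forall>n. (F ^^ n) z \<notin> ?N" by (rule collision.AE_funpow_not_in_null)
  then show ?thesis
  proof (rule AE_mp, intro AE_I2 impI notI)
    fix z assume z: "z \<in> space flux" "\<forall>n. (F ^^ n) z \<notin> ?N" "z \<in> escaping_set A B T"
    obtain n where "(F ^^ n) z \<in> exceptional" using escaping_visits_exceptional[OF z(3)] by blast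
    then have "(F ^^ n) z \<in> ?N" using N(1) by (auto simp: exceptional_def)
    then show False using z(2) by blast
  qed
qed

end

theorem theorem1:
  fixes A B T :: real and q :: nat
  assumes "0 < A" and "A < B" and "0 < T"
    and "classical_resonance A B q"
  shows "escaping_set A B T \<in> null_sets (phase_measure A B T) \<and>
         (AE z in phase_measure A B T. momentum_recurrent A B T z)"
proof -
  interpret resonant_accelerator A B T q
    using assms by unfold_locales (auto simp: classical_resonance_def)
  have X: "X \<in> sets lebesgue" using phase_cylinder_sets by simp
  have transfer: "AE z in phase_measure A B T. P z" if "AE z in flux. P z" for P
  proof -
    have "AE z in lebesgue. z \<in> X \<longrightarrow> P z"
      using that unfolding AE_flux_iff by (simp add: AE_completion_iff)
    then show ?thesis
      unfolding phase_measure_def using X by (subst AE_restrict_space_iff) auto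
  qed
  have "escaping_set A B T \<in> null_sets (phase_measure A B T)"
  proof -
    have "AE z in lebesgue. z \<in> X \<longrightarrow> z \<notin> escaping_set A B T"
      using AE_not_escaping unfolding AE_flux_iff by (simp add: AE_completion_iff)
    then obtain N where N: "{z \<in> space lebesgue. \<not> (z \<in> X \<longrightarrow> z \<notin> escaping_set A B T)} \<subseteq> N" "N \<in> null_sets lebesgue"
      by (auto elim!: AE_E simp: null_sets_def)
    have sub: "escaping_set A B T \<subseteq> X" by (auto simp: escaping_set_def)
    then have "escaping_set A B T \<subseteq> N" using N(1) by auto
    \<comment> \<open>Completeness of Lebesgue measure: a subset of a null set is measurable and
      null.\<close>
    then have "escaping_set A B T \<in> null_sets lebesgue"
      using N(2) negligible_subset by (simp add: negligible_iff_null_sets[symmetric])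
    then show ?thesis
      using sub X unfolding phase_measure_def by (subst null_sets_restrict_space) auto
  qed
  then show ?thesis using transfer[OF AE_momentum_recurrent[OF AE_not_escaping]] by blast
qed

end
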